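(* Let $K$ be a finite locally oriented simplicial complex, let $L,M$ be subcomplexes of $K$ such that $K=L\cup M$, and set $I:=L\cap M$. If $\mathscr{C}$ is a cosheaf of finite dimensional $\mathbb{F}$-vector spaces on $K$, then there is a short exact sequence of chain complexes $$0\longrightarrow C_{\bullet}(I;\mathscr{C}|_{I})\overset{p_{\bullet}}{\longrightarrow}C_{\bullet}(L;\mathscr{C}|_{L})\oplus C_{\bullet}(M;\mathscr{C}|_{M})\overset{q_{\bullet}}{\longrightarrow}C_{\bullet}(K;\mathscr{C})\longrightarrow 0,$$ where the middle term is the direct sum in the abelian category $\mathsf{Ch}_{\bullet}(\mathsf{Vect}^{\mathrm{fd}}_{\mathbb{F}})$ of chain complexes of finite dimensional $\mathbb{F}$-vector spaces.
   Context: $\mathbb{F}$ is a field. A finite simplicial complex $K$ (simplices are nonempty) is regarded as a poset under the face relation $\leq$; $K_k$ is its set of $k$-dimensional simplices. A local orientation is a total ordering of the vertices of each simplex such that the ordering of each face is the restriction of the ordering of the simplex; subcomplexes carry the restricted orientation. For $\sigma=(v_0,\dots,v_k)$ put $\sigma_{-i}=(v_0,\dots,v_{i-1},v_{i+1},\dots,v_k)$. The incidence symbol is $[\sigma:\tau]=+1$ if $\tau=\sigma_{-i}$ with $i$ even, $-1$ if $\tau=\sigma_{-i}$ with $i$ odd, and $0$ otherwise. A cosheaf on $K$ is a functor $\mathscr{C}:(K,\leq)^{\mathrm{op}}\to\mathsf{Vect}^{\mathrm{fd}}_{\mathbb{F}}$; write $\mathscr{C}_{\sigma\geq\tau}:\mathscr{C}(\sigma)\to\mathscr{C}(\tau)$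 for the map associated to $\tau\leq\sigma$. For a subcomplex $N\subseteq K$, $\mathscr{C}|_N$ is the restriction of the functor $\mathscr{C}$ to $(N,\leq)^{\mathrm{op}}$. The chain complex $C_\bullet(K;\mathscr{C})$ has $C_k(K;\mathscr{C})=\bigoplus_{\sigma\in K_k}\mathscr{C}(\sigma)$, and the block $\mathscr{C}(\sigma)\to\mathscr{C}(\tau)$ of the boundary map $\partial_k$ is $[\sigma:\tau]\cdot\mathscr{C}_{\sigma\geq\tau}$ (zero if $[\sigma:\tau]=0$). *)

theory Defs
  imports "Jordan_Normal_Form.Missing_VectorSpace"
begin

section \<open>Oriented simplicial complexes\<close>

definition finite_simplicial_complex :: "'v set set \<Rightarrow> bool"
  where "finite_simplicial_complex K \<longleftrightarrow>
    finite K \<and>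
    (\<forall>\<sigma>\<in>K. finite \<sigma> \<and> \<sigma> \<noteq> {}) \<and>
    (\<forall>\<sigma>\<in>K. \<forall>\<tau>. \<tau> \<noteq> {} \<and> \<tau> \<subseteq> \<sigma> \<longrightarrow> \<tau> \<in> K)"

definition subcomplex :: "'v set set \<Rightarrow> 'v set set \<Rightarrow> bool"
  where "subcomplex N K \<longleftrightarrow> finite_simplicial_complex N \<and> N \<subseteq> K"

text \<open>Degrees are integers; as simplices are nonempty, there are none of negative dimension.\<close>

definition simplices_of_dim :: "'v set set \<Rightarrow> int \<Rightarrow> 'v set set"
  where "simplices_of_dim K k = {\<sigma>\<in>K. int (card \<sigma>) = k + 1}"

text \<open>A local orientation assigns to each simplex \<open>\<sigma>\<close> a (reflexive) total order \<open>r \<sigma>\<close> of its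
  vertices. The orientation restricted to a subcomplex is the same \<open>r\<close>, looked at on fewer
  simplices only.\<close>

definition local_orientation :: "'v set set \<Rightarrow> ('v set \<Rightarrow> 'v rel) \<Rightarrow> bool"
  where "local_orientation K r \<longleftrightarrow>
    (\<forall>\<sigma>\<in>K. linear_order_on \<sigma> (r \<sigma>)) \<and>
    (\<forall>\<sigma>\<in>K. \<forall>\<tau>\<in>K. \<tau> \<subseteq> \<sigma> \<longrightarrow> r \<tau> = r \<sigma> \<inter> \<tau> \<times> \<tau>)"

text \<open>For \<open>\<sigma> = (v\<^sub>0, \<dots>, v\<^sub>k)\<close>, the vertex \<open>v\<^sub>i\<close> is the one with exactly \<open>i\<close> strict predecessors,
  so \<open>delete_vertex r \<sigma> i\<close> is the vertex set of \<open>(v\<^sub>0, \<dots>, v\<^bsub>i-1\<^esub>, v\<^bsub>i+1\<^esub>, \<dots>, v\<^sub>k)\<close>.\<close>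

definition delete_vertex :: "('v set \<Rightarrow> 'v rel) \<Rightarrow> 'v set \<Rightarrow> nat \<Rightarrow> 'v set"
  where "delete_vertex r \<sigma> i = {v\<in>\<sigma>. card (underS (r \<sigma>) v) \<noteq> i}"

definition incidence :: "('v set \<Rightarrow> 'v rel) \<Rightarrow> 'v set \<Rightarrow> 'v set \<Rightarrow> int"
  where "incidence r \<sigma> \<tau> =
    (if \<exists>i < card \<sigma>. even i \<and> \<tau> = delete_vertex r \<sigma> i then 1
     else if \<exists>i < card \<sigma>. odd i \<and> \<tau> = delete_vertex r \<sigma> i then -1
     else 0)"


section \<open>Cosheaves\<close>

definition fd_vectorspace :: "('f, 'm) ring_scheme \<Rightarrow> ('f, 'b, 'n) module_scheme \<Rightarrow> bool"
  where "fd_vectorspace F V \<longleftrightarrow> vectorspace F V \<and> vectorspace.fin_dim F V"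

text \<open>\<open>ext C \<sigma> \<tau>\<close> is the linear map from \<open>stalk C \<sigma>\<close> to \<open>stalk C \<tau>\<close> attached to \<open>\<tau> \<le> \<sigma>\<close>.\<close>

record ('v, 'f, 'b) cosheaf_data =
  stalk :: "'v set \<Rightarrow> ('f, 'b) module"
  ext :: "'v set \<Rightarrow> 'v set \<Rightarrow> 'b \<Rightarrow> 'b"

definition cosheaf ::
    "('f, 'm) ring_scheme \<Rightarrow> 'v set set \<Rightarrow> ('v, 'f, 'b) cosheaf_data \<Rightarrow> bool"
  where "cosheaf F K C \<longleftrightarrow>
    (\<forall>\<sigma>\<in>K. fd_vectorspace F (stalk C \<sigma>)) \<and>
    (\<forall>\<sigma>\<in>K. \<forall>\<tau>\<in>K. \<tau> \<subseteq> \<sigma> \<longrightarrow> linear_map F (stalk C \<sigma>) (stalk C \<tau>) (ext C \<sigma> \<tau>)) \<and>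
    (\<forall>\<sigma>\<in>K. \<forall>x\<in>carrier (stalk C \<sigma>). ext C \<sigma> \<sigma> x = x) \<and>
    (\<forall>\<sigma>\<in>K. \<forall>\<tau>\<in>K. \<forall>\<rho>\<in>K. \<rho> \<subseteq> \<tau> \<and> \<tau> \<subseteq> \<sigma> \<longrightarrow>
      (\<forall>x\<in>carrier (stalk C \<sigma>). ext C \<tau> \<rho> (ext C \<sigma> \<tau> x) = ext C \<sigma> \<rho> x))"

definition cosheaf_restrict ::
    "('v, 'f, 'b) cosheaf_data \<Rightarrow> 'v set set \<Rightarrow> ('v, 'f, 'b) cosheaf_data"
  where "cosheaf_restrict C N =
    \<lparr>stalk = restrict (stalk C) N,
     ext = (\<lambda>\<sigma>\<in>N. \<lambda>\<tau>\<in>N. ext C \<sigma> \<tau>)\<rparr>"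


section \<open>Chain complexes of finite dimensional vector spaces\<close>

text \<open>\<open>bdry A k\<close> maps \<open>chains A k\<close> to \<open>chains A (k - 1)\<close>.\<close>

record ('f, 'b) complex_data =
  chains :: "int \<Rightarrow> ('f, 'b) module"
  bdry :: "int \<Rightarrow> 'b \<Rightarrow> 'b"

definition fd_chain_complex :: "('f, 'm) ring_scheme \<Rightarrow> ('f, 'b) complex_data \<Rightarrow> bool"
  where "fd_chain_complex F A \<longleftrightarrow>
    (\<forall>k. fd_vectorspace F (chains A k)) \<and>
    (\<forall>k. linear_map F (chains A k) (chains A (k - 1)) (bdry A k)) \<and>
    (\<forall>k. \<forall>x\<in>carrier (chains A k). bdry A (k - 1) (bdry A k x) = \<zero>\<^bsub>chains A (k - 2)\<^esub>)"

definition chain_map ::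
    "('f, 'm) ring_scheme \<Rightarrow> ('f, 'b) complex_data \<Rightarrow> ('f, 'c) complex_data \<Rightarrow>
     (int \<Rightarrow> 'b \<Rightarrow> 'c) \<Rightarrow> bool"
  where "chain_map F A B f \<longleftrightarrow>
    (\<forall>k. linear_map F (chains A k) (chains B k) (f k)) \<and>
    (\<forall>k. \<forall>x\<in>carrier (chains A k). f (k - 1) (bdry A k x) = bdry B k (f k x))"

definition direct_sum_complex ::
    "('f, 'b) complex_data \<Rightarrow> ('f, 'c) complex_data \<Rightarrow> ('f, 'b \<times> 'c) complex_data"
  where "direct_sum_complex A B =
    \<lparr>chains = (\<lambda>k. direct_sum (chains A k) (chains B k)),
     bdry = (\<lambda>k. map_prod (bdry A k) (bdry B k))\<rparr>"

text \<open>Exactness of \<open>0 \<rightarrow> A \<rightarrow> B \<rightarrow> D \<rightarrow> 0\<close>; kernels and images of chain maps are formed degreewise.\<close>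

definition short_exact_complexes ::
    "('f, 'm) ring_scheme \<Rightarrow> ('f, 'b) complex_data \<Rightarrow> (int \<Rightarrow> 'b \<Rightarrow> 'c) \<Rightarrow>
     ('f, 'c) complex_data \<Rightarrow> (int \<Rightarrow> 'c \<Rightarrow> 'd) \<Rightarrow> ('f, 'd) complex_data \<Rightarrow> bool"
  where "short_exact_complexes F A p B q D \<longleftrightarrow>
    fd_chain_complex F A \<and> fd_chain_complex F B \<and> fd_chain_complex F D \<and>
    chain_map F A B p \<and> chain_map F B D q \<and>
    (\<forall>k. mod_hom.ker (chains A k) (chains B k) (p k) = {\<zero>\<^bsub>chains A k\<^esub>}) \<and>
    (\<forall>k. p k ` carrier (chains A k) = mod_hom.ker (chains B k) (chains D k) (q k)) \<and>
    (\<forall>k. q k ` carrier (chains B k) = carrier (chains D k))"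


section \<open>The chain complex of a cosheaf\<close>

text \<open>Direct sum of a finite family, realised as the product. The fields \<open>mult\<close> and \<open>one\<close> exist
  only because HOL-Algebra modules extend rings; they play no role.\<close>

definition family_direct_sum :: "'i set \<Rightarrow> ('i \<Rightarrow> ('f, 'b) module) \<Rightarrow> ('f, 'i \<Rightarrow> 'b) module"
  where "family_direct_sum S V =
    \<lparr>carrier = (\<Pi>\<^sub>E i\<in>S. carrier (V i)),
     mult = (\<lambda>x y. \<lambda>i\<in>S. \<zero>\<^bsub>V i\<^esub>),
     one = (\<lambda>i\<in>S. \<zero>\<^bsub>V i\<^esub>),
     zero = (\<lambda>i\<in>S. \<zero>\<^bsub>V i\<^esub>),
     add = (\<lambda>x y. \<lambda>i\<in>S. x i \<oplus>\<^bsub>V i\<^esub> y i),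
     smult = (\<lambda>a x. \<lambda>i\<in>S. a \<odot>\<^bsub>V i\<^esub> x i)\<rparr>"

text \<open>The integer \<open>incidence r \<sigma> \<tau>\<close> acts by integer multiples in the additive group of
  \<open>stalk C \<tau>\<close>. The zeroth multiple of anything is \<open>\<zero>\<close>, so simplices \<open>\<sigma>\<close> that do not have \<open>\<tau>\<close> as
  a facet contribute nothing.\<close>

definition cosheaf_complex ::
    "'v set set \<Rightarrow> ('v set \<Rightarrow> 'v rel) \<Rightarrow> ('v, 'f, 'b) cosheaf_data \<Rightarrow>
     ('f, 'v set \<Rightarrow> 'b) complex_data"
  where "cosheaf_complex K r C =
    \<lparr>chains = (\<lambda>k. family_direct_sum (simplices_of_dim K k) (stalk C)),
     bdry = (\<lambda>k x. \<lambda>\<tau>\<in>simplices_of_dim K (k - 1).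
       \<Oplus>\<^bsub>stalk C \<tau>\<^esub>\<sigma>\<in>simplices_of_dim K k.
         [incidence r \<sigma> \<tau>] \<cdot>\<^bsub>stalk C \<tau>\<^esub> ext C \<sigma> \<tau> (x \<sigma>))\<rparr>"

end

theory Submission
  imports Defs
begin

text \<open>
  In each degree the sequence is the Mayer--Vietoris sequence of the index sets
  \<open>L\<^sub>k \<inter> M\<^sub>k\<close>, \<open>L\<^sub>k\<close>, \<open>M\<^sub>k\<close> and \<open>L\<^sub>k \<union> M\<^sub>k\<close>. With \<open>\<epsilon>\<close> for extension of a family by zero to a larger
  index set, take \<open>p x = (\<epsilon> x, \<epsilon> x)\<close> and \<open>q (y, z) = \<epsilon> y - \<epsilon> z\<close>. Then \<open>p\<close> is injective because \<open>\<epsilon>\<close> is.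
  If \<open>\<epsilon> y = \<epsilon> z\<close>, then \<open>y\<close> and \<open>z\<close> agree on the intersection and vanish elsewhere, so both are
  extensions of the same family on the intersection
  (\<open>zero_extend_exact_middle\<close>). Finally \<open>w\<close> is hit by \<open>q\<close>: put its part on \<open>L\<^sub>k\<close> in the first summand
  and minus the remaining part in the second
  (\<open>zero_extend_difference_surjective\<close>).

  The maps \<open>p\<close> and \<open>q\<close> are chain maps because \<open>\<epsilon>\<close> is one
  (\<open>zero_extend_chain_map\<close>). This is where subcomplexes enter: a facet of a simplex of \<open>N\<close> lies in \<open>N\<close>,
  so the boundary of a chain carried by \<open>N\<close> has no component outside \<open>N\<close>.

  The definition of exactness also demands that all three terms be complexes of finite dimensional
  vector spaces. Finite dimensionality holds since a finite direct sum is spanned by the images of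
  its summands (\<open>fin_dim_if_covered\<close>). For \<open>\<partial>\<partial> = 0\<close>, functoriality shows that the composites
  \<open>\<sigma> \<rightarrow> \<tau> \<rightarrow> \<rho>\<close> through the various \<open>\<tau>\<close> all equal the map from \<open>\<sigma>\<close> to \<open>\<rho>\<close> up to the factor
  \<open>[\<sigma>:\<tau>][\<tau>:\<rho>]\<close>, and these integers sum to zero (\<open>incidence_square_zero\<close>): exactly two faces lie
  between \<open>\<sigma>\<close> and \<open>\<rho> = \<sigma> - {v, w}\<close>, and they carry opposite signs.

  Restricting the cosheaf to a subcomplex does not change the complex built from it
  (\<open>cosheaf_complex_restrict\<close>), so all complexes can be formed from one and the same cosheaf.
\<close>

section \<open>Linear maps and finite sums\<close>

lemma linear_mapI:
  assumes "vectorspace F V" "vectorspace F W"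
    and "\<And>x. x \<in> carrier V \<Longrightarrow> T x \<in> carrier W"
    and "\<And>x y. x \<in> carrier V \<Longrightarrow> y \<in> carrier V \<Longrightarrow> T (x \<oplus>\<^bsub>V\<^esub> y) = T x \<oplus>\<^bsub>W\<^esub> T y"
    and "\<And>a x. a \<in> carrier F \<Longrightarrow> x \<in> carrier V \<Longrightarrow> T (a \<odot>\<^bsub>V\<^esub> x) = a \<odot>\<^bsub>W\<^esub> T x"
  shows "linear_map F V W T"
  using assms
  by (auto simp: linear_map_def mod_hom_def mod_hom_axioms_def module_hom_def vectorspace.axioms)

lemma linear_map_closed: "linear_map F V W T \<Longrightarrow> x \<in> carrier V \<Longrightarrow> T x \<in> carrier W"
  by (meson linear_map.T_im)

lemma linear_map_add:
  "linear_map F V W T \<Longrightarrow> x \<in> carrier V \<Longrightarrow> y \<in> carrier V \<Longrightarrow> T (x \<oplus>\<^bsub>V\<^esub> y) = T x \<oplus>\<^bsub>W\<^esub> T y"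
  by (meson linear_map.T_add)

lemma linear_map_smult:
  "linear_map F V W T \<Longrightarrow> a \<in> carrier F \<Longrightarrow> x \<in> carrier V \<Longrightarrow> T (a \<odot>\<^bsub>V\<^esub> x) = a \<odot>\<^bsub>W\<^esub> T x"
  by (meson linear_map.T_smult)

lemma linear_map_zero_vec: "linear_map F V W T \<Longrightarrow> T \<zero>\<^bsub>V\<^esub> = \<zero>\<^bsub>W\<^esub>"
  by (meson linear_map.T0_is_0)

lemma linear_map_vectorspaces:
  assumes "linear_map F V W T" shows "vectorspace F V" "vectorspace F W"
  using assms by (auto simp: linear_map_def)

lemma vectorspace_abelian_group: "vectorspace F V \<Longrightarrow> abelian_group V"
  by (meson module.axioms(2) vectorspace.axioms(1))

lemma linear_map_const_zero:
  assumes "vectorspace F V" "vectorspace F W"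
  shows "linear_map F V W (\<lambda>x. \<zero>\<^bsub>W\<^esub>)"
proof -
  interpret W: vectorspace F W by fact
  show ?thesis by (rule linear_mapI) (use assms in auto)
qed

lemma linear_map_compose:
  assumes "linear_map F V W T" "linear_map F U V S"
  shows "linear_map F U W (\<lambda>x. T (S x))"
  by (rule linear_mapI)
     (use assms in \<open>auto simp: linear_map_vectorspaces linear_map_closed linear_map_add linear_map_smult\<close>)

lemma linear_map_smult_const:
  assumes "vectorspace F V" "a \<in> carrier F"
  shows "linear_map F V V (\<lambda>x. a \<odot>\<^bsub>V\<^esub> x)"
proof -
  interpret vectorspace F V by fact
  show ?thesis
    by (rule linear_mapI)
       (use assms in \<open>auto simp: smult_r_distr smult_assoc1[symmetric] R.m_comm\<close>)
qed

lemma linear_map_add_pow: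
  fixes n :: int
  assumes "linear_map F V W T" "x \<in> carrier V"
  shows "T ([n] \<cdot>\<^bsub>V\<^esub> x) = [n] \<cdot>\<^bsub>W\<^esub> T x"
proof -
  interpret V: vectorspace F V using assms(1) by (rule linear_map_vectorspaces)
  interpret W: vectorspace F W using assms(1) by (rule linear_map_vectorspaces)
  interpret T: linear_map F V W T by fact
  have "T \<in> hom (add_monoid V) (add_monoid W)"
    by (auto simp: hom_def)
  then show ?thesis
    using hom_int_pow[of T "add_monoid V" "add_monoid W" x n] assms(2)
      V.M.a_group W.M.a_group by (simp add: add_pow_def)
qed

lemma linear_map_add_multiple:
  fixes n :: int
  assumes "linear_map F V W T"
  shows "linear_map F V W (\<lambda>x. [n] \<cdot>\<^bsub>W\<^esub> T x)"
proof -
  interpret V: vectorspace F V using assms(1) by (rule linear_map_vectorspaces)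
  interpret W: vectorspace F W using assms(1) by (rule linear_map_vectorspaces)
  interpret T: linear_map F V W T by fact
  show ?thesis
    by (rule linear_mapI)
       (use V.vectorspace_axioms W.vectorspace_axioms
            linear_map_add_pow[OF linear_map_smult_const[OF W.vectorspace_axioms]]
         in \<open>auto simp: W.M.add.int_pow_distrib\<close>)
qed

lemma linear_map_finsum:
  assumes "vectorspace F V" "vectorspace F W" "finite S" "\<And>i. i \<in> S \<Longrightarrow> linear_map F V W (T i)"
  shows "linear_map F V W (\<lambda>x. \<Oplus>\<^bsub>W\<^esub>i\<in>S. T i x)"
  using assms(3,4)
proof (induction S rule: finite_induct)
  case empty
  then show ?case
    using linear_map_const_zero[OF assms(1,2)] vectorspace_abelian_group[OF assms(2)]
    by (simp add: abelian_group.axioms(1) abelian_monoid.finsum_empty)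
next
  case (insert i S)
  interpret V: vectorspace F V by fact
  interpret W: vectorspace F W by fact
  have i: "linear_map F V W (T i)" and S: "linear_map F V W (\<lambda>x. \<Oplus>\<^bsub>W\<^esub>i\<in>S. T i x)"
    using insert by auto
  have eq: "(\<Oplus>\<^bsub>W\<^esub>i\<in>insert i S. T i x) = T i x \<oplus>\<^bsub>W\<^esub> (\<Oplus>\<^bsub>W\<^esub>i\<in>S. T i x)" if "x \<in> carrier V" for x
    using insert.hyps linear_map_closed[OF insert.prems] that by (intro W.M.finsum_insert) auto
  show ?case
    by (rule linear_mapI)
       (simp_all add: assms eq linear_map_closed[OF i] linear_map_closed[OF S] linear_map_add[OF i]
        linear_map_add[OF S] linear_map_smult[OF i] linear_map_smult[OF S] W.M.a_ac W.smult_r_distr)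
qed

lemma linear_map_of_finsum:
  assumes "linear_map F V W T" "finite S" "\<And>i. i \<in> S \<Longrightarrow> x i \<in> carrier V"
  shows "T (\<Oplus>\<^bsub>V\<^esub>i\<in>S. x i) = (\<Oplus>\<^bsub>W\<^esub>i\<in>S. T (x i))"
proof -
  interpret V: vectorspace F V using assms(1) by (rule linear_map_vectorspaces)
  interpret W: vectorspace F W using assms(1) by (rule linear_map_vectorspaces)
  interpret T: linear_map F V W T by fact
  show ?thesis
    using assms(2,3)
  proof (induction S rule: finite_induct)
    case (insert i S)
    have "(\<Oplus>\<^bsub>V\<^esub>i\<in>insert i S. x i) = x i \<oplus>\<^bsub>V\<^esub> (\<Oplus>\<^bsub>V\<^esub>i\<in>S. x i)"
      using insert by (intro V.M.finsum_insert) auto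
    moreover have "(\<Oplus>\<^bsub>W\<^esub>i\<in>insert i S. T (x i)) = T (x i) \<oplus>\<^bsub>W\<^esub> (\<Oplus>\<^bsub>W\<^esub>i\<in>S. T (x i))"
      using insert by (intro W.M.finsum_insert) auto
    moreover have "(\<Oplus>\<^bsub>V\<^esub>i\<in>S. x i) \<in> carrier V"
      using insert by (intro V.M.finsum_closed) auto
    ultimately show ?case using insert by simp
  qed simp
qed

lemma linear_map_minus:
  assumes T: "linear_map F V W T" and S: "linear_map F V W S"
  shows "linear_map F V W (\<lambda>x. T x \<ominus>\<^bsub>W\<^esub> S x)"
proof -
  interpret W: vectorspace F W using T by (rule linear_map_vectorspaces)
  have V: "vectorspace F V" using T by (rule linear_map_vectorspaces)
  show ?thesis
    by (rule linear_mapI)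
       (simp_all add: V W.vectorspace_axioms linear_map_closed[OF T] linear_map_closed[OF S]
         linear_map_add[OF T] linear_map_add[OF S] linear_map_smult[OF T] linear_map_smult[OF S]
         a_minus_def W.M.minus_add W.M.a_ac W.smult_r_distr W.smult_r_minus)
qed

lemma linear_map_diff:
  assumes "linear_map F V W T" "x \<in> carrier V" "y \<in> carrier V"
  shows "T (x \<ominus>\<^bsub>V\<^esub> y) = T x \<ominus>\<^bsub>W\<^esub> T y"
  using assms by (meson linear_map.T_minus)

lemma linear_map_ker:
  assumes "linear_map F V W T"
  shows "mod_hom.ker V W T = {x \<in> carrier V. T x = \<zero>\<^bsub>W\<^esub>}"
  using assms by (auto simp: linear_map_def mod_hom.ker_def)

lemma (in abelian_monoid) finsum_swap:
  assumes "finite A" "finite B" "\<And>i j. i \<in> A \<Longrightarrow> j \<in> B \<Longrightarrow> f i j \<in> carrier G"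
  shows "(\<Oplus>i\<in>A. \<Oplus>j\<in>B. f i j) = (\<Oplus>j\<in>B. \<Oplus>i\<in>A. f i j)"
  using assms(1,3)
proof (induction A rule: finite_induct)
  case (insert a A)
  have "(\<Oplus>i\<in>insert a A. \<Oplus>j\<in>B. f i j) = (\<Oplus>j\<in>B. f a j) \<oplus> (\<Oplus>i\<in>A. \<Oplus>j\<in>B. f i j)"
    using insert by (intro finsum_insert) (auto intro!: finsum_closed)
  also have "\<dots> = (\<Oplus>j\<in>B. f a j) \<oplus> (\<Oplus>j\<in>B. \<Oplus>i\<in>A. f i j)"
    using insert by simp
  also have "\<dots> = (\<Oplus>j\<in>B. f a j \<oplus> (\<Oplus>i\<in>A. f i j))"
    using insert by (intro finsum_addf[symmetric]) (auto intro!: finsum_closed)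
  also have "\<dots> = (\<Oplus>j\<in>B. \<Oplus>i\<in>insert a A. f i j)"
    using insert by (intro finsum_cong') (auto intro!: finsum_closed finsum_insert[symmetric])
  finally show ?case .
qed simp

lemma (in abelian_group) finsum_add_pow:
  fixes n :: "'i \<Rightarrow> int"
  assumes "finite A" "z \<in> carrier G"
  shows "(\<Oplus>i\<in>A. [n i] \<cdot> z) = [(\<Sum>i\<in>A. n i)] \<cdot> z"
  using assms(1)
proof (induction A rule: finite_induct)
  case empty
  then show ?case by (simp add: add_pow_def)
next
  case (insert a A)
  have "(\<Oplus>i\<in>insert a A. [n i] \<cdot> z) = [n a] \<cdot> z \<oplus> (\<Oplus>i\<in>A. [n i] \<cdot> z)"
    using insert.hyps assms(2) by (intro finsum_insert) auto
  then show ?case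
    using insert assms(2) by (simp add: add.int_pow_mult)
qed

lemma (in abelian_group) minus_eq_zero_iff:
  assumes "x \<in> carrier G" "y \<in> carrier G"
  shows "x \<ominus> y = \<zero> \<longleftrightarrow> x = y"
proof
  assume "x \<ominus> y = \<zero>"
  then show "x = y" using minus_equality[of x "\<ominus> y"] assms by (simp add: a_minus_def)
qed (simp add: assms a_minus_def r_neg)

text \<open>The fold that defines a finite sum evaluates the summand on the index set only, so congruence
  holds even for summands outside the carrier. This is needed to identify two boundary operators as
  total functions, hence also on arguments that are not chains.\<close>

lemma finsum_cong_unconditional:
  assumes "\<And>i. i \<in> A \<Longrightarrow> f i = g i"
  shows "finsum G f A = finsum G g A"
proof -
  let ?m = "mult (add_monoid G)" and ?D = "carrier (add_monoid G)" and ?e = "one (add_monoid G)"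
  have "(A, z) \<in> foldSetD ?D (?m \<circ> g) ?e"
    if "(A, z) \<in> foldSetD ?D (?m \<circ> f) ?e" "\<And>i. i \<in> A \<Longrightarrow> f i = g i" for f g A z
    using that
  proof (induction rule: foldSetD.induct)
    case (insertI i A z)
    have "(insert i A, (?m \<circ> g) i z) \<in> foldSetD ?D (?m \<circ> g) ?e"
      using insertI by (intro foldSetD.insertI) (simp_all add: comp_def)
    then show ?case using insertI.prems by (simp add: comp_def)
  qed (rule foldSetD.emptyI)
  from this[of A _ f g] this[of A _ g f]
  have "(A, z) \<in> foldSetD ?D (?m \<circ> f) ?e \<longleftrightarrow> (A, z) \<in> foldSetD ?D (?m \<circ> g) ?e" for z
    using assms by auto
  then show ?thesis
    unfolding finsum_def finprod_def foldD_def by (simp only:)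
qed

section \<open>Direct sums of finite dimensional vector spaces\<close>

lemma restrict_eq_iff_extensional:
  assumes "x \<in> extensional S"
  shows "restrict f S = x \<longleftrightarrow> (\<forall>i\<in>S. f i = x i)"
proof
  assume "\<forall>i\<in>S. f i = x i"
  then show "restrict f S = x"
    using assms by (intro extensionalityI[of _ S]) auto
qed auto

lemma family_direct_sum_simps:
  "carrier (family_direct_sum S V) = (\<Pi>\<^sub>E i\<in>S. carrier (V i))"
  "zero (family_direct_sum S V) = (\<lambda>i\<in>S. \<zero>\<^bsub>V i\<^esub>)"
  "x \<oplus>\<^bsub>family_direct_sum S V\<^esub> y = (\<lambda>i\<in>S. x i \<oplus>\<^bsub>V i\<^esub> y i)"
  "a \<odot>\<^bsub>family_direct_sum S V\<^esub> x = (\<lambda>i\<in>S. a \<odot>\<^bsub>V i\<^esub> x i)"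
  by (simp_all add: family_direct_sum_def)

lemma family_direct_sum_cong:
  assumes "\<And>i. i \<in> S \<Longrightarrow> V i = W i"
  shows "family_direct_sum S V = family_direct_sum S W"
  using assms by (auto simp: family_direct_sum_def fun_eq_iff restrict_def intro!: PiE_cong)

lemma family_direct_sum_vectorspace:
  assumes "field F" and V: "\<And>i. i \<in> S \<Longrightarrow> vectorspace F (V i)"
  shows "vectorspace F (family_direct_sum S V)"
proof -
  have mod: "module F (V i)" if "i \<in> S" for i using V[OF that] by (simp add: vectorspace.axioms)
  have ab: "abelian_group (V i)" if "i \<in> S" for i using V[OF that] by (rule vectorspace_abelian_group)
  note am = ab[THEN abelian_group.axioms(1)]
  have inv: "\<exists>n\<in>carrier (family_direct_sum S V).
      v \<oplus>\<^bsub>family_direct_sum S V\<^esub> n = \<zero>\<^bsub>family_direct_sum S V\<^esub>"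
    if "v \<in> carrier (family_direct_sum S V)" for v
    using that
    by (intro bexI[of _ "\<lambda>i\<in>S. \<ominus>\<^bsub>V i\<^esub> v i"])
       (auto simp: family_direct_sum_simps abelian_group.a_inv_closed[OF ab] abelian_group.r_neg[OF ab]
          PiE_iff intro!: restrict_ext)
  show ?thesis
  proof (rule vs_criteria[OF assms(1)], goal_cases)
    case 3 then show ?case using inv by blast
  next
    case 6 then show ?case
      by (auto simp: family_direct_sum_simps PiE_iff abelian_monoid.a_assoc[OF am] intro!: restrict_ext)
  next
    case 5 then show ?case
      by (auto simp: family_direct_sum_simps PiE_iff abelian_monoid.a_comm[OF am] intro!: restrict_ext)
  next
    case 7 then show ?case
      by (auto simp: family_direct_sum_simps PiE_iff abelian_monoid.r_zero[OF am] restrict_eq_iff_extensional)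
  next
    case 9 then show ?case
      by (auto simp: family_direct_sum_simps PiE_iff module.smult_one[OF mod] restrict_eq_iff_extensional)
  qed (auto simp: family_direct_sum_simps PiE_iff abelian_monoid.a_closed[OF am]
        abelian_monoid.zero_closed[OF am] module.smult_closed[OF mod] 
        module.smult_assoc1[OF mod] module.smult_l_distr[OF mod] module.smult_r_distr[OF mod]
        intro!: restrict_ext)
qed

lemma linear_map_coordinate:
  assumes "field F" "\<And>i. i \<in> S \<Longrightarrow> vectorspace F (V i)" "i \<in> S"
  shows "linear_map F (family_direct_sum S V) (V i) (\<lambda>x. x i)"
  by (rule linear_mapI) (use assms in \<open>auto simp: family_direct_sum_vectorspace family_direct_sum_simps\<close>)

lemma linear_map_into_family:
  assumes "field F" "vectorspace F U" "\<And>i. i \<in> S \<Longrightarrow> linear_map F U (V i) (T i)"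
  shows "linear_map F U (family_direct_sum S V) (\<lambda>x. \<lambda>i\<in>S. T i x)"
proof (rule linear_mapI)
  show "vectorspace F (family_direct_sum S V)"
    using assms linear_map_vectorspaces(2) by (intro family_direct_sum_vectorspace) blast+
qed (use assms(2) in \<open>auto simp: family_direct_sum_simps linear_map_closed[OF assms(3)]
       linear_map_add[OF assms(3)] linear_map_smult[OF assms(3)] intro!: restrict_ext\<close>)

lemma family_direct_sum_diff:
  assumes F: "field F" and V: "\<And>i. i \<in> S \<Longrightarrow> vectorspace F (V i)"
    and "x \<in> carrier (family_direct_sum S V)" "y \<in> carrier (family_direct_sum S V)" "i \<in> S"
  shows "(x \<ominus>\<^bsub>family_direct_sum S V\<^esub> y) i = x i \<ominus>\<^bsub>V i\<^esub> y i"
  using linear_map_diff[OF linear_map_coordinate[where V = V and S = S, OF F V]] assms(3-5) by blast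

lemma linear_map_pair:
  fixes W :: "('f, 'b) module" and U :: "('f, 'c) module"
  assumes T: "linear_map F V W T" and S: "linear_map F V U S"
  shows "linear_map F V (direct_sum W U) (\<lambda>x. (T x, S x))"
  by (rule linear_mapI)
     (simp_all add: direct_sum_def direct_sum_is_vs[unfolded direct_sum_def]
        linear_map_vectorspaces[OF T] linear_map_vectorspaces[OF S]
        linear_map_closed[OF T] linear_map_closed[OF S] linear_map_add[OF T] linear_map_add[OF S]
        linear_map_smult[OF T] linear_map_smult[OF S])

lemma linear_map_fst:
  fixes W :: "('f, 'b) module" and U :: "('f, 'c) module"
  assumes "vectorspace F W" "vectorspace F U"
  shows "linear_map F (direct_sum W U) W fst"
  by (rule linear_mapI) (use assms in \<open>auto simp: direct_sum_is_vs, auto simp: direct_sum_def\<close>)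

lemma linear_map_snd:
  fixes W :: "('f, 'b) module" and U :: "('f, 'c) module"
  assumes "vectorspace F W" "vectorspace F U"
  shows "linear_map F (direct_sum W U) U snd"
  by (rule linear_mapI) (use assms in \<open>auto simp: direct_sum_is_vs, auto simp: direct_sum_def\<close>)

text \<open>The vectors that \<open>T\<close> sends into the span of the image of a generating set form a submodule
  containing that generating set, hence are all of \<open>V\<close>.\<close>

lemma finite_spanning_of_image:
  assumes "linear_map F V W T" "vectorspace.fin_dim F V"
  shows "\<exists>B. finite B \<and> B \<subseteq> carrier W \<and> T ` carrier V \<subseteq> module.span F W B"
proof -
  interpret V: vectorspace F V using assms(1) by (rule linear_map_vectorspaces)
  interpret W: vectorspace F W using assms(1) by (rule linear_map_vectorspaces)
  interpret T: linear_map F V W T by fact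
  obtain A where A: "finite A" "A \<subseteq> carrier V" "V.span A = carrier V"
    using assms(2) unfolding V.fin_dim_def by blast
  have TA: "T ` A \<subseteq> carrier W" using A by auto
  have sub: "submodule F (W.span (T ` A)) W" using TA by (rule W.span_is_submodule)
  have "submodule F {x \<in> carrier V. T x \<in> W.span (T ` A)} V"
  proof (rule submodule.intro)
    show "module F V" by (rule V.module_axioms)
  qed (use submodule.m_closed[OF sub] submodule.zero_closed[OF sub] submodule.smult_closed[OF sub] in simp_all)
  moreover have "A \<subseteq> {x \<in> carrier V. T x \<in> W.span (T ` A)}"
    using A W.in_own_span[OF TA] by auto
  ultimately have "V.span A \<subseteq> {x \<in> carrier V. T x \<in> W.span (T ` A)}"
    by (rule V.span_is_subset[rotated])
  then show ?thesis using A TA by (intro exI[of _ "T ` A"]) auto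
qed

text \<open>Taking the union of the sets \<open>B\<close> gives finitely many vectors whose span contains every \<open>X i\<close>.
  The last hypothesis says that the \<open>X i\<close> generate \<open>W\<close>; it is phrased through submodules because
  this form is easy to check for direct sums.\<close>

lemma fin_dim_if_covered:
  assumes W: "vectorspace F W" and "finite S"
    and B: "\<And>i. i \<in> S \<Longrightarrow> \<exists>B. finite B \<and> B \<subseteq> carrier W \<and> X i \<subseteq> module.span F W B"
    and all: "\<And>U. submodule F U W \<Longrightarrow> (\<And>i. i \<in> S \<Longrightarrow> X i \<subseteq> U) \<Longrightarrow> carrier W \<subseteq> U"
  shows "vectorspace.fin_dim F W"
proof -
  interpret W: vectorspace F W by fact
  obtain B where B: "\<And>i. i \<in> S \<Longrightarrow> finite (B i) \<and> B i \<subseteq> carrier W \<and> X i \<subseteq> W.span (B i)"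
    using B by metis
  let ?B = "\<Union>i\<in>S. B i"
  have sub: "?B \<subseteq> carrier W" using B by blast
  have "carrier W \<subseteq> W.span ?B"
  proof (rule all)
    show "submodule F (W.span ?B) W" using sub by (rule W.span_is_submodule)
    show "X i \<subseteq> W.span ?B" if "i \<in> S" for i
      using B[OF that] W.span_is_monotone[of "B i" ?B] that by blast
  qed
  then show ?thesis
    using B assms(2) sub W.span_is_subset2[OF sub] unfolding W.fin_dim_def by (intro exI[of _ ?B]) auto
qed

lemma direct_sum_fd:
  fixes V :: "('f, 'b) module" and W :: "('f, 'c) module"
  assumes V: "fd_vectorspace F V" and W: "fd_vectorspace F W"
  shows "fd_vectorspace F (direct_sum V W)"
proof -
  have vs: "vectorspace F (direct_sum V W)"
    using assms by (simp add: fd_vectorspace_def direct_sum_is_vs)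
  let ?T = "\<lambda>b. if b then inj1 V W ` carrier V else inj2 V W ` carrier W"
  interpret V: vectorspace F V using V by (simp add: fd_vectorspace_def)
  interpret W: vectorspace F W using W by (simp add: fd_vectorspace_def)
  have "vectorspace.fin_dim F (direct_sum V W)"
  proof (rule fin_dim_if_covered[OF vs, of UNIV ?T])
    show "\<exists>B. finite B \<and> B \<subseteq> carrier (direct_sum V W) \<and> ?T b \<subseteq> module.span F (direct_sum V W) B" for b
      using finite_spanning_of_image[OF inj1_linear[OF V.vectorspace_axioms W.vectorspace_axioms]]
        finite_spanning_of_image[OF inj2_linear[OF V.vectorspace_axioms W.vectorspace_axioms]] assms
      by (cases b) (simp_all add: fd_vectorspace_def)
    fix U assume U: "submodule F U (direct_sum V W)" and T: "\<And>b. b \<in> UNIV \<Longrightarrow> ?T b \<subseteq> U"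
    show "carrier (direct_sum V W) \<subseteq> U"
    proof
      fix x assume x: "x \<in> carrier (direct_sum V W)"
      then have "inj1 V W (fst x) \<in> U" "inj2 V W (snd x) \<in> U"
        using T[of True] T[of False] by (auto simp: direct_sum_def)
      then have "inj1 V W (fst x) \<oplus>\<^bsub>direct_sum V W\<^esub> inj2 V W (snd x) \<in> U"
        using U by (simp add: submodule.m_closed)
      then show "x \<in> U" using x by (auto simp: direct_sum_def inj1_def inj2_def)
    qed
  qed auto
  with vs show ?thesis by (simp add: fd_vectorspace_def)
qed

lemma family_direct_sum_fd:
  assumes F: "field F" and fin: "finite S" and V: "\<And>i. i \<in> S \<Longrightarrow> fd_vectorspace F (V i)"
  shows "fd_vectorspace F (family_direct_sum S V)"
proof -
  let ?W = "family_direct_sum S V"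
  let ?e = "\<lambda>j v. \<lambda>i\<in>S. if i = j then v else \<zero>\<^bsub>V i\<^esub>"
  have Vs: "vectorspace F (V i)" if "i \<in> S" for i using V[OF that] by (simp add: fd_vectorspace_def)
  have vs: "vectorspace F ?W" using F Vs by (rule family_direct_sum_vectorspace)
  have am: "abelian_monoid (V i)" if "i \<in> S" for i
    using Vs[OF that] vectorspace_abelian_group abelian_group.axioms(1) by blast
  have e: "linear_map F (V j) ?W (?e j)" if j: "j \<in> S" for j
  proof (rule linear_map_into_family[OF F Vs[OF j]])
    show "linear_map F (V j) (V i) (\<lambda>v. if i = j then v else \<zero>\<^bsub>V i\<^esub>)" if i: "i \<in> S" for i
    proof (cases "i = j")
      case True
      then show ?thesis using Vs[OF j] by (auto intro: linear_mapI)
    next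
      case False
      then show ?thesis using linear_map_const_zero[OF Vs[OF j] Vs[OF i]] by simp
    qed
  qed
  have "vectorspace.fin_dim F ?W"
  proof (rule fin_dim_if_covered[OF vs fin, of "\<lambda>j. ?e j ` carrier (V j)"])
    show "\<exists>B. finite B \<and> B \<subseteq> carrier ?W \<and> ?e j ` carrier (V j) \<subseteq> module.span F ?W B"
      if "j \<in> S" for j
      using finite_spanning_of_image[OF e[OF that]] V[OF that] by (simp add: fd_vectorspace_def)
    fix U assume U: "submodule F U ?W" and T: "\<And>j. j \<in> S \<Longrightarrow> ?e j ` carrier (V j) \<subseteq> U"
    \<comment> \<open>The truncation of \<open>x\<close> to \<open>J\<close> is a sum of vectors supported at a single index.\<close>
    have "(\<lambda>i\<in>S. if i \<in> J then x i else \<zero>\<^bsub>V i\<^esub>) \<in> U"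
      if "finite J" "J \<subseteq> S" "x \<in> carrier ?W" for J x
      using that(1,2)
    proof (induction J rule: finite_induct)
      case empty
      show ?case using submodule.zero_closed[OF U] by (simp only: family_direct_sum_simps empty_iff if_False)
    next
      case (insert j J)
      have xi: "i \<in> S \<Longrightarrow> x i \<in> carrier (V i)" for i using that(3) by (auto simp: family_direct_sum_simps)
      have "?e j (x j) \<in> U" using T insert xi by blast
      then have "?e j (x j) \<oplus>\<^bsub>?W\<^esub> (\<lambda>i\<in>S. if i \<in> J then x i else \<zero>\<^bsub>V i\<^esub>) \<in> U"
        using insert by (intro submodule.m_closed[OF U]) blast+
      moreover have "?e j (x j) \<oplus>\<^bsub>?W\<^esub> (\<lambda>i\<in>S. if i \<in> J then x i else \<zero>\<^bsub>V i\<^esub>)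
          = (\<lambda>i\<in>S. if i \<in> insert j J then x i else \<zero>\<^bsub>V i\<^esub>)"
        using insert.hyps xi
        by (auto simp: family_direct_sum_simps abelian_monoid.l_zero[OF am] abelian_monoid.r_zero[OF am]
            abelian_monoid.zero_closed[OF am] intro!: restrict_ext)
      ultimately show ?case by metis
    qed
    note truncate = this
    show "carrier ?W \<subseteq> U"
    proof
      fix x assume x: "x \<in> carrier ?W"
      then have "(\<lambda>i\<in>S. if i \<in> S then x i else \<zero>\<^bsub>V i\<^esub>) = x"
        by (auto simp: family_direct_sum_simps PiE_iff restrict_eq_iff_extensional)
      then show "x \<in> U" using truncate[OF fin order_refl x] by simp
    qed
  qed
  with vs show ?thesis by (simp add: fd_vectorspace_def)
qed

section \<open>Chain maps into and out of a direct sum\<close>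

lemma chain_map_pair:
  assumes f: "chain_map F A B f" and g: "chain_map F A D g"
  shows "chain_map F A (direct_sum_complex B D) (\<lambda>k x. (f k x, g k x))"
  using assms by (simp add: chain_map_def direct_sum_complex_def linear_map_pair)

lemma chain_map_difference:
  assumes f: "chain_map F A D f" and g: "chain_map F B D g" and D: "fd_chain_complex F D"
  shows "chain_map F (direct_sum_complex A B) D
    (\<lambda>k x. f k (fst x) \<ominus>\<^bsub>chains D k\<^esub> g k (snd x))"
  unfolding chain_map_def
proof (intro conjI allI ballI)
  have lin: "linear_map F (chains A k) (chains D k) (f k)" "linear_map F (chains B k) (chains D k) (g k)" for k
    using f g by (simp_all add: chain_map_def)
  show "linear_map F (chains (direct_sum_complex A B) k) (chains D k)
      (\<lambda>x. f k (fst x) \<ominus>\<^bsub>chains D k\<^esub> g k (snd x))" for k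
    unfolding direct_sum_complex_def using lin[of k]
    by (auto intro!: linear_map_minus linear_map_compose[OF _ linear_map_fst]
        linear_map_compose[OF _ linear_map_snd] dest: linear_map_vectorspaces)
  fix k x assume "x \<in> carrier (chains (direct_sum_complex A B) k)"
  then have x: "fst x \<in> carrier (chains A k)" "snd x \<in> carrier (chains B k)"
    by (auto simp: direct_sum_complex_def direct_sum_def)
  have "linear_map F (chains D k) (chains D (k - 1)) (bdry D k)"
    using D by (simp add: fd_chain_complex_def)
  from linear_map_diff[OF this linear_map_closed[OF lin(1) x(1)] linear_map_closed[OF lin(2) x(2)]]
  show "f (k - 1) (fst (bdry (direct_sum_complex A B) k x)) \<ominus>\<^bsub>chains D (k - 1)\<^esub>
      g (k - 1) (snd (bdry (direct_sum_complex A B) k x))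
      = bdry D k (f k (fst x) \<ominus>\<^bsub>chains D k\<^esub> g k (snd x))"
    using f g x by (simp add: chain_map_def direct_sum_complex_def)
qed

lemma direct_sum_fd_chain_complex:
  assumes A: "fd_chain_complex F A" and B: "fd_chain_complex F B"
  shows "fd_chain_complex F (direct_sum_complex A B)"
proof -
  have vs: "vectorspace F (chains A k)" "vectorspace F (chains B k)" for k
    using A B by (simp_all add: fd_chain_complex_def fd_vectorspace_def)
  have eq: "map_prod f g = (\<lambda>x. (f (fst x), g (snd x)))" for f g
    by (auto simp: fun_eq_iff)
  have "linear_map F (direct_sum (chains A k) (chains B k))
      (direct_sum (chains A (k - 1)) (chains B (k - 1))) (map_prod (bdry A k) (bdry B k))" for k
    unfolding eq using A B vs
    by (intro linear_map_pair linear_map_compose[OF _ linear_map_fst] linear_map_compose[OF _ linear_map_snd])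
       (auto simp: fd_chain_complex_def)
  moreover have "map_prod (bdry A (k - 1)) (bdry B (k - 1)) (map_prod (bdry A k) (bdry B k) x)
      = \<zero>\<^bsub>direct_sum (chains A (k - 2)) (chains B (k - 2))\<^esub>"
    if "x \<in> carrier (direct_sum (chains A k) (chains B k))" for k x
    using that A B by (cases x) (simp add: fd_chain_complex_def direct_sum_def)
  ultimately show ?thesis
    using A B by (simp add: fd_chain_complex_def direct_sum_complex_def direct_sum_fd)
qed

section \<open>The Mayer--Vietoris sequence of a family of vector spaces\<close>

text \<open>The extension by zero from \<open>S\<close> to \<open>T\<close>. Like the elements of a direct sum of a family, its values are
  undefined off \<open>T\<close>.\<close>

definition zero_extend :: "('i \<Rightarrow> ('f, 'b) module) \<Rightarrow> 'i set \<Rightarrow> 'i set \<Rightarrow> ('i \<Rightarrow> 'b) \<Rightarrow> 'i \<Rightarrow> 'b"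
  where "zero_extend V S T x = (\<lambda>i\<in>T. if i \<in> S then x i else \<zero>\<^bsub>V i\<^esub>)"

lemma zero_extend_linear:
  assumes F: "field F" and V: "\<And>i. i \<in> T \<Longrightarrow> vectorspace F (V i)" and ST: "S \<subseteq> T"
  shows "linear_map F (family_direct_sum S V) (family_direct_sum T V) (zero_extend V S T)"
  unfolding zero_extend_def[abs_def]
proof (rule linear_map_into_family[OF F])
  have VS: "vectorspace F (V i)" if "i \<in> S" for i using V ST that by blast
  show vs: "vectorspace F (family_direct_sum S V)"
    using F VS by (rule family_direct_sum_vectorspace)
  show "linear_map F (family_direct_sum S V) (V i) (\<lambda>x. if i \<in> S then x i else \<zero>\<^bsub>V i\<^esub>)" if "i \<in> T" for i
    using linear_map_coordinate[where V = V and S = S, OF F VS] linear_map_const_zero[OF vs V[OF that]]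
    by (cases "i \<in> S") simp_all
qed

context
  fixes F :: "('f, 'm) ring_scheme" and V :: "'i \<Rightarrow> ('f, 'b) module" and S T :: "'i set"
  assumes F: "field F" and V: "\<And>i. i \<in> S \<union> T \<Longrightarrow> vectorspace F (V i)"
begin

lemma zero_extend_into_union_linear:
  shows "linear_map F (family_direct_sum S V) (family_direct_sum (S \<union> T) V) (zero_extend V S (S \<union> T))"
    and "linear_map F (family_direct_sum T V) (family_direct_sum (S \<union> T) V) (zero_extend V T (S \<union> T))"
  using F V by (auto intro!: zero_extend_linear)

lemma zero_extend_pair_injective:
  assumes x: "x \<in> carrier (family_direct_sum (S \<inter> T) V)"
    and "zero_extend V (S \<inter> T) S x = \<zero>\<^bsub>family_direct_sum S V\<^esub>"
  shows "x = \<zero>\<^bsub>family_direct_sum (S \<inter> T) V\<^esub>"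
proof -
  have "x i = \<zero>\<^bsub>V i\<^esub>" if "i \<in> S \<inter> T" for i
    using fun_cong[OF assms(2), of i] that by (simp add: zero_extend_def family_direct_sum_simps)
  moreover have "x \<in> extensional (S \<inter> T)"
    using x by (simp add: family_direct_sum_simps PiE_iff)
  ultimately show ?thesis
    by (intro extensionalityI[of _ "S \<inter> T"]) (auto simp: family_direct_sum_simps)
qed

text \<open>The difference \<open>q (y, w)\<close> vanishes iff the two extensions coincide. On \<open>S \<inter> T\<close> this says that \<open>y\<close> and
  \<open>w\<close> agree, on \<open>S - T\<close> that \<open>y = 0\<close>, and on \<open>T - S\<close> that \<open>w = 0\<close>.\<close>

lemma zero_extend_exact_middle:
  "(\<lambda>x. (zero_extend V (S \<inter> T) S x, zero_extend V (S \<inter> T) T x)) ` carrier (family_direct_sum (S \<inter> T) V)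
   = {y \<in> carrier (direct_sum (family_direct_sum S V) (family_direct_sum T V)).
       zero_extend V S (S \<union> T) (fst y) \<ominus>\<^bsub>family_direct_sum (S \<union> T) V\<^esub>
       zero_extend V T (S \<union> T) (snd y) = \<zero>\<^bsub>family_direct_sum (S \<union> T) V\<^esub>}"
  (is "?p ` _ = {y \<in> _. ?q y = _}")
proof -
  have ab: "abelian_group (family_direct_sum (S \<union> T) V)"
    using F V by (intro vectorspace_abelian_group[of F] family_direct_sum_vectorspace)
  have am: "abelian_monoid (V i)" if "i \<in> S \<union> T" for i
    using vectorspace_abelian_group[OF V[OF that]] by (rule abelian_group.axioms)
  note z = abelian_monoid.zero_closed[OF am]
  have cS: "zero_extend V S (S \<union> T) y \<in> carrier (family_direct_sum (S \<union> T) V)"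
    if "y \<in> carrier (family_direct_sum S V)" for y
    using linear_map_closed[OF zero_extend_into_union_linear(1) that] .
  have cT: "zero_extend V T (S \<union> T) y \<in> carrier (family_direct_sum (S \<union> T) V)"
    if "y \<in> carrier (family_direct_sum T V)" for y
    using linear_map_closed[OF zero_extend_into_union_linear(2) that] .
  have ker: "?q (y, w) = \<zero>\<^bsub>family_direct_sum (S \<union> T) V\<^esub> \<longleftrightarrow>
      zero_extend V S (S \<union> T) y = zero_extend V T (S \<union> T) w"
    if "y \<in> carrier (family_direct_sum S V)" "w \<in> carrier (family_direct_sum T V)" for y w
    using abelian_group.minus_eq_zero_iff[OF ab cS cT] that by simp
  show ?thesis
  proof (intro equalityI subsetI)
    fix u assume "u \<in> ?p ` carrier (family_direct_sum (S \<inter> T) V)"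
    then obtain x where x: "x \<in> carrier (family_direct_sum (S \<inter> T) V)" and u: "u = ?p x" by blast
    have 1: "zero_extend V (S \<inter> T) S x \<in> carrier (family_direct_sum S V)"
        "zero_extend V (S \<inter> T) T x \<in> carrier (family_direct_sum T V)"
      using x z by (auto simp: zero_extend_def family_direct_sum_simps PiE_iff)
    have "zero_extend V S (S \<union> T) (zero_extend V (S \<inter> T) S x)
        = zero_extend V T (S \<union> T) (zero_extend V (S \<inter> T) T x)"
      unfolding zero_extend_def by (intro restrict_ext) auto
    then show "u \<in> {y \<in> carrier (direct_sum (family_direct_sum S V) (family_direct_sum T V)).
        ?q y = \<zero>\<^bsub>family_direct_sum (S \<union> T) V\<^esub>}"
      using 1 ker[OF 1] by (simp add: u direct_sum_def)
  next
    fix u assume u: "u \<in> {y \<in> carrier (direct_sum (family_direct_sum S V) (family_direct_sum T V)).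
        ?q y = \<zero>\<^bsub>family_direct_sum (S \<union> T) V\<^esub>}"
    obtain y w where yw: "u = (y, w)" by fastforce
    have y: "y \<in> carrier (family_direct_sum S V)" and w: "w \<in> carrier (family_direct_sum T V)"
      using u by (auto simp: yw direct_sum_def)
    have "zero_extend V S (S \<union> T) y = zero_extend V T (S \<union> T) w"
      using u ker[OF y w] by (simp add: yw)
    then have eq: "(if i \<in> S then y i else \<zero>\<^bsub>V i\<^esub>) = (if i \<in> T then w i else \<zero>\<^bsub>V i\<^esub>)" if "i \<in> S \<union> T" for i
      using that by (auto simp: zero_extend_def dest!: fun_cong[of _ _ i])
    let ?x = "\<lambda>i\<in>S \<inter> T. y i"
    have "?x \<in> carrier (family_direct_sum (S \<inter> T) V)"
      using y by (auto simp: family_direct_sum_simps PiE_iff)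
    moreover have "y = zero_extend V (S \<inter> T) S ?x"
    proof (rule extensionalityI[of _ S])
      show "y i = zero_extend V (S \<inter> T) S ?x i" if "i \<in> S" for i
        using eq[of i] that by (simp add: zero_extend_def split: if_splits)
    qed (use y in \<open>auto simp: family_direct_sum_simps zero_extend_def PiE_iff\<close>)
    moreover have "w = zero_extend V (S \<inter> T) T ?x"
    proof (rule extensionalityI[of _ T])
      show "w i = zero_extend V (S \<inter> T) T ?x i" if "i \<in> T" for i
        using eq[of i] that by (simp add: zero_extend_def split: if_splits)
    qed (use w in \<open>auto simp: family_direct_sum_simps zero_extend_def PiE_iff\<close>)
    ultimately show "u \<in> ?p ` carrier (family_direct_sum (S \<inter> T) V)"
      unfolding yw by (metis (no_types, lifting) image_eqI)
  qed
qed

lemma zero_extend_difference_surjective: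
  "(\<lambda>y. zero_extend V S (S \<union> T) (fst y) \<ominus>\<^bsub>family_direct_sum (S \<union> T) V\<^esub>
      zero_extend V T (S \<union> T) (snd y)) `
     carrier (direct_sum (family_direct_sum S V) (family_direct_sum T V))
   = carrier (family_direct_sum (S \<union> T) V)"
  (is "?q ` ?D = _")
proof (intro equalityI subsetI)
  have lin: "linear_map F (direct_sum (family_direct_sum S V) (family_direct_sum T V))
      (family_direct_sum (S \<union> T) V) ?q"
    using F V
    by (intro linear_map_minus linear_map_compose[OF zero_extend_linear linear_map_fst]
        linear_map_compose[OF zero_extend_linear linear_map_snd] family_direct_sum_vectorspace) auto
  show "w \<in> carrier (family_direct_sum (S \<union> T) V)" if "w \<in> ?q ` ?D" for w
    using that linear_map_closed[OF lin] by blast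
  have ab: "abelian_group (V i)" if "i \<in> S \<union> T" for i
    using V[OF that] by (rule vectorspace_abelian_group)
  note am = ab[THEN abelian_group.axioms(1)]
  fix w assume w: "w \<in> carrier (family_direct_sum (S \<union> T) V)"
  then have wi: "w i \<in> carrier (V i)" if "i \<in> S \<union> T" for i
    using that by (auto simp: family_direct_sum_simps)
  \<comment> \<open>Indices in \<open>S \<inter> T\<close> are served by the first summand alone; the sign compensates the
    difference in \<open>q\<close>.\<close>
  let ?y = "\<lambda>i\<in>S. w i" and ?z = "\<lambda>i\<in>T. if i \<in> S then \<zero>\<^bsub>V i\<^esub> else \<ominus>\<^bsub>V i\<^esub> w i"
  have y: "?y \<in> carrier (family_direct_sum S V)"
    using wi by (auto simp: family_direct_sum_simps)
  have z: "?z \<in> carrier (family_direct_sum T V)"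
    using wi abelian_monoid.zero_closed[OF am] abelian_group.a_inv_closed[OF ab]
    by (auto simp: family_direct_sum_simps)
  have yz: "(?y, ?z) \<in> ?D" using y z by (simp add: direct_sum_def)
  have "?q (?y, ?z) i = w i" if i: "i \<in> S \<union> T" for i
  proof -
    interpret Vi: abelian_group "V i" using ab[OF i] .
    have "?q (?y, ?z) i = zero_extend V S (S \<union> T) ?y i \<ominus>\<^bsub>V i\<^esub> zero_extend V T (S \<union> T) ?z i"
      using family_direct_sum_diff[where V = V and S = "S \<union> T", OF F V
          linear_map_closed[OF zero_extend_into_union_linear(1) y]
          linear_map_closed[OF zero_extend_into_union_linear(2) z] i]
      by simp
    also have "\<dots> = w i"
      using i wi[OF i] by (auto simp: zero_extend_def a_minus_def)
    finally show ?thesis .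
  qed
  moreover have "?q (?y, ?z) \<in> extensional (S \<union> T)" "w \<in> extensional (S \<union> T)"
    using linear_map_closed[OF lin yz] w by (simp_all add: family_direct_sum_simps PiE_iff)
  ultimately have "w = ?q (?y, ?z)"
    by (intro extensionalityI[of _ "S \<union> T"]) auto
  then show "w \<in> ?q ` ?D" using yz by (rule image_eqI)
qed

end

section \<open>Incidence numbers\<close>

lemma finite_simplicial_complex_face:
  assumes "finite_simplicial_complex K" "\<sigma> \<in> K" "\<tau> \<subseteq> \<sigma>" "\<tau> \<noteq> {}"
  shows "\<tau> \<in> K"
  using assms unfolding finite_simplicial_complex_def by blast

lemma finite_simplicial_complex_Int:
  assumes A: "finite_simplicial_complex A" and B: "finite_simplicial_complex B"
  shows "finite_simplicial_complex (A \<inter> B)"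
proof -
  have "finite A" "\<forall>\<sigma>\<in>A. finite \<sigma> \<and> \<sigma> \<noteq> {}"
    using A by (simp_all add: finite_simplicial_complex_def)
  moreover have "\<tau> \<in> A \<inter> B" if "\<sigma> \<in> A \<inter> B" "\<tau> \<noteq> {} \<and> \<tau> \<subseteq> \<sigma>" for \<sigma> \<tau>
    using that finite_simplicial_complex_face[OF A, of \<sigma> \<tau>] finite_simplicial_complex_face[OF B, of \<sigma> \<tau>]
    by simp
  ultimately show ?thesis
    unfolding finite_simplicial_complex_def by (metis IntD1 finite_Int)
qed

lemma simplices_of_dim_subset: "simplices_of_dim N k \<subseteq> N"
  by (auto simp: simplices_of_dim_def)

lemma card_underS_less:
  assumes R: "linear_order_on S R" and fin: "finite S" and "(v, w) \<in> R" "v \<noteq> w"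
  shows "card (underS R v) < card (underS R w)"
proof (rule psubset_card_mono)
  have tr: "trans R" "antisym R" "R \<subseteq> S \<times> S"
    using R by (auto simp: order_on_defs refl_on_def)
  show "finite (underS R w)"
    using fin tr by (auto simp: underS_def intro: finite_subset[of _ S])
  have "v \<in> underS R w" "v \<notin> underS R v"
    using assms by (auto simp: underS_def)
  moreover have "underS R v \<subseteq> underS R w"
    using assms tr unfolding underS_def by (auto dest: transD antisymD)
  ultimately show "underS R v \<subset> underS R w" by blast
qed

text \<open>The number of strict predecessors is the position in the order: \<open>v\<^sub>i\<close> has position \<open>i\<close>. So every index
  below \<open>card \<sigma>\<close> deletes exactly one vertex, and different indices delete different vertices.\<close>

lemma bij_betw_card_underS:
  assumes R: "linear_order_on S R" and fin: "finite S"
  shows "bij_betw (\<lambda>v. card (underS R v)) S {..<card S}"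
proof -
  have inj: "inj_on (\<lambda>v. card (underS R v)) S"
  proof (rule inj_onI, rule ccontr)
    fix v w assume "v \<in> S" "w \<in> S" "card (underS R v) = card (underS R w)" "v \<noteq> w"
    then show False
      using card_underS_less[OF R fin, of v w] card_underS_less[OF R fin, of w v] R
      by (auto simp: order_on_defs total_on_def)
  qed
  have "card (underS R v) < card S" if "v \<in> S" for v
  proof (rule psubset_card_mono[OF fin])
    show "underS R v \<subset> S"
      using R that by (auto simp: underS_def order_on_defs refl_on_def)
  qed
  then have "(\<lambda>v. card (underS R v)) ` S = {..<card S}"
    using inj by (intro card_subset_eq) (auto simp: card_image)
  with inj show ?thesis by (simp add: bij_betw_def)
qed

lemma delete_vertex_card_underS:
  assumes R: "linear_order_on \<sigma> (r \<sigma>)" and fin: "finite \<sigma>" and v: "v \<in> \<sigma>"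
  shows "delete_vertex r \<sigma> (card (underS (r \<sigma>) v)) = \<sigma> - {v}"
  using bij_betw_imp_inj_on[OF bij_betw_card_underS[OF R fin]] v
  by (auto simp: delete_vertex_def inj_on_def)

lemma incidence_delete:
  assumes R: "linear_order_on \<sigma> (r \<sigma>)" and fin: "finite \<sigma>" and v: "v \<in> \<sigma>"
  shows "incidence r \<sigma> (\<sigma> - {v}) = (-1) ^ card (underS (r \<sigma>) v)"
proof -
  let ?p = "\<lambda>v. card (underS (r \<sigma>) v)"
  have "?p v < card \<sigma>"
    using bij_betw_card_underS[OF R fin] v by (auto simp: bij_betw_def)
  moreover have "\<sigma> - {v} = delete_vertex r \<sigma> i \<longleftrightarrow> i = ?p v" if "i < card \<sigma>" for i
  proof
    assume "\<sigma> - {v} = delete_vertex r \<sigma> i"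
    then show "i = ?p v" using v by (auto simp: delete_vertex_def)
  qed (simp add: delete_vertex_card_underS[where r = r, OF R fin v])
  ultimately show ?thesis
    unfolding incidence_def by (auto simp: uminus_power_if)
qed

lemma incidence_nonzeroE:
  assumes R: "linear_order_on \<sigma> (r \<sigma>)" and fin: "finite \<sigma>" and "incidence r \<sigma> \<tau> \<noteq> 0"
  obtains v where "v \<in> \<sigma>" "\<tau> = \<sigma> - {v}"
proof -
  obtain i where i: "i < card \<sigma>" "\<tau> = delete_vertex r \<sigma> i"
    using assms(3) by (auto simp: incidence_def split: if_splits)
  then obtain v where v: "v \<in> \<sigma>" "i = card (underS (r \<sigma>) v)"
    using bij_betw_imp_surj_on[OF bij_betw_card_underS[OF R fin]] by (metis imageE lessThan_iff)
  then show thesis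
    using that[OF v(1)] i(2) delete_vertex_card_underS[where r = r, OF R fin v(1)] by simp
qed

lemma incidence_nonzero_subset:
  assumes K: "finite_simplicial_complex K" and or: "local_orientation K r"
    and "\<sigma> \<in> K" and nz: "incidence r \<sigma> \<tau> \<noteq> 0"
  shows "\<tau> \<subseteq> \<sigma>"
proof -
  have "linear_order_on \<sigma> (r \<sigma>)" "finite \<sigma>"
    using assms(3) or K unfolding local_orientation_def finite_simplicial_complex_def by blast+
  then show ?thesis
    using nz by (elim incidence_nonzeroE) auto
qed

text \<open>Say \<open>v\<close> and \<open>w\<close> have positions \<open>a < b\<close> in \<open>\<sigma>\<close>. Deleting \<open>w\<close> leaves the position of \<open>v\<close> unchanged, but
  deleting \<open>v\<close> moves \<open>w\<close> down to position \<open>b - 1\<close>. The two products are therefore \<open>(-1)^(a + b - 1)\<close> and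
  \<open>(-1)^(b + a)\<close>.\<close>

lemma incidence_cancel:
  assumes K: "finite_simplicial_complex K" and or: "local_orientation K r"
    and \<sigma>: "\<sigma> \<in> K" and vw: "(v, w) \<in> r \<sigma>" "v \<noteq> w" and \<rho>: "\<sigma> - {v, w} \<in> K"
  shows "incidence r \<sigma> (\<sigma> - {v}) * incidence r (\<sigma> - {v}) (\<sigma> - {v, w})
    + incidence r \<sigma> (\<sigma> - {w}) * incidence r (\<sigma> - {w}) (\<sigma> - {v, w}) = 0"
proof -
  have lin: "linear_order_on \<sigma>' (r \<sigma>')" and fin: "finite \<sigma>'" if "\<sigma>' \<in> K" for \<sigma>'
    using or K that unfolding local_orientation_def finite_simplicial_complex_def by blast+
  have rS: "r \<sigma> \<subseteq> \<sigma> \<times> \<sigma>" "antisym (r \<sigma>)"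
    using lin[OF \<sigma>] by (auto simp: order_on_defs refl_on_def)
  have v: "v \<in> \<sigma>" and w: "w \<in> \<sigma>" using rS vw by auto
  have faces: "\<sigma> - {v} \<in> K" "\<sigma> - {w} \<in> K"
    using v w vw(2) by (auto intro!: finite_simplicial_complex_face[OF K \<sigma>])
  have restr: "r (\<sigma> - {x}) = r \<sigma> \<inter> (\<sigma> - {x}) \<times> (\<sigma> - {x})" if "\<sigma> - {x} \<in> K" for x
    using or \<sigma> that unfolding local_orientation_def by blast
  have fu: "finite (underS (r \<sigma>) w)"
    using rS fin[OF \<sigma>] by (auto simp: underS_def intro: finite_subset[of _ \<sigma>])
  have uw: "underS (r (\<sigma> - {v})) w = underS (r \<sigma>) w - {v}"
    unfolding restr[OF faces(1)] using rS vw w by (auto simp: underS_def)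
  have uv: "underS (r (\<sigma> - {w})) v = underS (r \<sigma>) v"
    unfolding restr[OF faces(2)] using rS vw v by (auto simp: underS_def dest: antisymD)
  have "v \<in> underS (r \<sigma>) w" using vw by (simp add: underS_def)
  then have c: "card (underS (r \<sigma>) w) = Suc (card (underS (r (\<sigma> - {v})) w))"
    unfolding uw using fu by (metis card_Suc_Diff1)
  have "incidence r (\<sigma> - {v}) (\<sigma> - {v} - {w}) = (-1) ^ card (underS (r (\<sigma> - {v})) w)"
    using w vw faces by (intro incidence_delete lin fin) auto
  moreover have "incidence r (\<sigma> - {w}) (\<sigma> - {w} - {v}) = (-1) ^ card (underS (r (\<sigma> - {w})) v)"
    using v vw faces by (intro incidence_delete lin fin) auto
  moreover have "\<sigma> - {v} - {w} = \<sigma> - {v, w}" "\<sigma> - {w} - {v} = \<sigma> - {v, w}" by auto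
  ultimately show ?thesis
    using incidence_delete[where r = r, OF lin[OF \<sigma>] fin[OF \<sigma>] v] incidence_delete[where r = r, OF lin[OF \<sigma>] fin[OF \<sigma>] w]
    by (simp add: c uv)
qed

text \<open>A summand can be nonzero only if \<open>\<rho> = \<sigma> - {v, w}\<close> and \<open>\<tau>\<close> is one of the two intermediate faces
  \<open>\<sigma> - {v}\<close> and \<open>\<sigma> - {w}\<close>. Both belong to the complex, being nonempty faces of \<open>\<sigma>\<close>.\<close>

lemma incidence_square_zero:
  assumes K: "finite_simplicial_complex K" and or: "local_orientation K r"
    and \<sigma>: "\<sigma> \<in> simplices_of_dim K k" and \<rho>: "\<rho> \<in> simplices_of_dim K (k - 2)"
  shows "(\<Sum>\<tau>\<in>simplices_of_dim K (k - 1). incidence r \<sigma> \<tau> * incidence r \<tau> \<rho>) = 0"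
proof (cases "\<rho> \<subseteq> \<sigma>")
  case True
  have lin: "linear_order_on \<sigma>' (r \<sigma>')" and fin: "finite \<sigma>'" if "\<sigma>' \<in> K" for \<sigma>'
    using or K that unfolding local_orientation_def finite_simplicial_complex_def by blast+
  have \<sigma>K: "\<sigma> \<in> K" and \<rho>K: "\<rho> \<in> K" and cards: "card \<sigma> = card \<rho> + 2"
    using \<sigma> \<rho> by (auto simp: simplices_of_dim_def)
  have "card (\<sigma> - \<rho>) = 2"
    using cards card_Diff_subset[OF fin[OF \<rho>K] True] by simp
  then obtain a b where ab: "\<sigma> - \<rho> = {a, b}" "a \<noteq> b" by (auto simp: card_2_iff)
  then have "(a, b) \<in> r \<sigma> \<or> (b, a) \<in> r \<sigma>"
    using lin[OF \<sigma>K] by (auto simp: order_on_defs total_on_def)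
  then obtain v w where vw: "\<sigma> - \<rho> = {v, w}" "v \<noteq> w" "(v, w) \<in> r \<sigma>"
    using ab by (metis insert_commute)
  have \<rho>eq: "\<rho> = \<sigma> - {v, w}" and v: "v \<in> \<sigma>" and w: "w \<in> \<sigma>" using vw True by auto
  have faces: "\<sigma> - {v} \<in> K" "\<sigma> - {w} \<in> K"
    using v w vw(2) by (auto intro!: finite_simplicial_complex_face[OF K \<sigma>K])
  have sub: "{\<sigma> - {v}, \<sigma> - {w}} \<subseteq> simplices_of_dim K (k - 1)"
    using \<sigma> faces card_Suc_Diff1[OF fin[OF \<sigma>K] v] card_Suc_Diff1[OF fin[OF \<sigma>K] w]
    by (simp add: simplices_of_dim_def)
  have "incidence r \<sigma> \<tau> * incidence r \<tau> \<rho> = 0"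
    if "\<tau> \<in> simplices_of_dim K (k - 1) - {\<sigma> - {v}, \<sigma> - {w}}" for \<tau>
  proof (rule ccontr)
    assume "incidence r \<sigma> \<tau> * incidence r \<tau> \<rho> \<noteq> 0"
    then have nz: "incidence r \<sigma> \<tau> \<noteq> 0" "incidence r \<tau> \<rho> \<noteq> 0" by auto
    have \<tau>: "\<tau> \<in> K" using that by (simp add: simplices_of_dim_def)
    obtain x where x: "x \<in> \<sigma>" "\<tau> = \<sigma> - {x}" using incidence_nonzeroE[where r = r, OF lin[OF \<sigma>K] fin[OF \<sigma>K] nz(1)] .
    obtain y where "y \<in> \<tau>" "\<rho> = \<tau> - {y}" using incidence_nonzeroE[where r = r, OF lin[OF \<tau>] fin[OF \<tau>] nz(2)] .
    with x that vw show False by auto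
  qed
  moreover have "finite (simplices_of_dim K (k - 1))"
    using K by (simp add: simplices_of_dim_def finite_simplicial_complex_def)
  ultimately have "(\<Sum>\<tau>\<in>simplices_of_dim K (k - 1). incidence r \<sigma> \<tau> * incidence r \<tau> \<rho>)
      = (\<Sum>\<tau>\<in>{\<sigma> - {v}, \<sigma> - {w}}. incidence r \<sigma> \<tau> * incidence r \<tau> \<rho>)"
    using sub by (intro sum.mono_neutral_right) auto
  moreover have "\<sigma> - {v} \<noteq> \<sigma> - {w}" using v w vw by auto
  ultimately show ?thesis
    using incidence_cancel[OF K or \<sigma>K vw(3,2)] \<rho>K by (simp add: \<rho>eq)
next
  case False
  have "incidence r \<sigma> \<tau> * incidence r \<tau> \<rho> = 0" if "\<tau> \<in> simplices_of_dim K (k - 1)" for \<tau>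
  proof (rule ccontr)
    assume "incidence r \<sigma> \<tau> * incidence r \<tau> \<rho> \<noteq> 0"
    then have nz: "incidence r \<sigma> \<tau> \<noteq> 0" "incidence r \<tau> \<rho> \<noteq> 0" by auto
    have "\<sigma> \<in> K" "\<tau> \<in> K" using \<sigma> that by (auto simp: simplices_of_dim_def)
    then show False
      using nz incidence_nonzero_subset[OF K or] False by blast
  qed
  then show ?thesis by (intro sum.neutral) blast
qed

section \<open>The complex of a cosheaf\<close>

text \<open>The block of the boundary operator from \<open>stalk C \<sigma>\<close> to \<open>stalk C \<tau>\<close>. It vanishes when \<open>\<tau>\<close> is not a facet
  of \<open>\<sigma>\<close>, whatever \<open>ext C \<sigma> \<tau>\<close> is there.\<close>

definition facet_map :: "('v set \<Rightarrow> 'v rel) \<Rightarrow> ('v, 'f, 'b) cosheaf_data \<Rightarrow> 'v set \<Rightarrow> 'v set \<Rightarrow> 'b \<Rightarrow> 'b"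
  where "facet_map r C \<sigma> \<tau> x = [incidence r \<sigma> \<tau>] \<cdot>\<^bsub>stalk C \<tau>\<^esub> ext C \<sigma> \<tau> x"

lemma facet_map_zero_incidence: "incidence r \<sigma> \<tau> = 0 \<Longrightarrow> facet_map r C \<sigma> \<tau> x = \<zero>\<^bsub>stalk C \<tau>\<^esub>"
  by (simp add: facet_map_def add_pow_def)

lemma cosheaf_complex_simps:
  "chains (cosheaf_complex K r C) k = family_direct_sum (simplices_of_dim K k) (stalk C)"
  "bdry (cosheaf_complex K r C) k x = (\<lambda>\<tau>\<in>simplices_of_dim K (k - 1).
     \<Oplus>\<^bsub>stalk C \<tau>\<^esub>\<sigma>\<in>simplices_of_dim K k. facet_map r C \<sigma> \<tau> (x \<sigma>))"
  by (simp_all add: cosheaf_complex_def facet_map_def)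

text \<open>Chains and boundaries over \<open>N\<close> only look at stalks and extension maps of simplices of \<open>N\<close>, where
  \<open>C\<close> and its restriction coincide.\<close>

lemma cosheaf_complex_restrict:
  "cosheaf_complex N r (cosheaf_restrict C N) = cosheaf_complex N r C"
proof -
  have sub: "\<sigma> \<in> N" if "\<sigma> \<in> simplices_of_dim N k" for \<sigma> k
    using that simplices_of_dim_subset by blast
  have "family_direct_sum (simplices_of_dim N k) (stalk (cosheaf_restrict C N))
      = family_direct_sum (simplices_of_dim N k) (stalk C)" for k
    by (rule family_direct_sum_cong) (simp add: cosheaf_restrict_def sub)
  moreover have "bdry (cosheaf_complex N r (cosheaf_restrict C N)) k x = bdry (cosheaf_complex N r C) k x" for k x
    unfolding cosheaf_complex_simps
  proof (rule restrict_ext)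
    fix \<tau> assume \<tau>: "\<tau> \<in> simplices_of_dim N (k - 1)"
    have "finsum (stalk C \<tau>) (\<lambda>\<sigma>. facet_map r (cosheaf_restrict C N) \<sigma> \<tau> (x \<sigma>)) (simplices_of_dim N k)
      = finsum (stalk C \<tau>) (\<lambda>\<sigma>. facet_map r C \<sigma> \<tau> (x \<sigma>)) (simplices_of_dim N k)"
      by (rule finsum_cong_unconditional) (simp add: facet_map_def cosheaf_restrict_def sub sub[OF \<tau>])
    then show "finsum (stalk (cosheaf_restrict C N) \<tau>)
        (\<lambda>\<sigma>. facet_map r (cosheaf_restrict C N) \<sigma> \<tau> (x \<sigma>)) (simplices_of_dim N k)
      = finsum (stalk C \<tau>) (\<lambda>\<sigma>. facet_map r C \<sigma> \<tau> (x \<sigma>)) (simplices_of_dim N k)"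
      by (simp add: cosheaf_restrict_def sub[OF \<tau>])
  qed
  ultimately show ?thesis
    by (intro complex_data.equality) (auto simp: fun_eq_iff cosheaf_complex_simps)
qed

text \<open>The hypotheses are inherited by subcomplexes, so the results below can be used for \<open>K\<close> as well as
  for its subcomplexes, with the same orientation and cosheaf.\<close>

locale oriented_cosheaf =
  fixes F :: "('f, 'm) ring_scheme" and K :: "'v set set"
    and r :: "'v set \<Rightarrow> 'v rel" and C :: "('v, 'f, 'b) cosheaf_data"
  assumes field: "field F" and complex: "finite_simplicial_complex K"
    and orientation: "local_orientation K r" and cosheaf: "cosheaf F K C"
begin

lemma oriented_cosheaf_subcomplex:
  assumes "subcomplex N K"
  shows "oriented_cosheaf F N r C"
proof (rule oriented_cosheaf.intro)
  show "field F" by (rule field)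
  show "finite_simplicial_complex N" using assms by (simp add: subcomplex_def)
  have NK: "\<sigma> \<in> K" if "\<sigma> \<in> N" for \<sigma> using assms that by (auto simp: subcomplex_def)
  show "local_orientation N r"
    using orientation unfolding local_orientation_def by (elim conjE, intro conjI ballI impI; metis NK)
  show "cosheaf F N C"
    using cosheaf unfolding cosheaf_def by (elim conjE, intro conjI ballI impI; metis NK)
qed

lemma finite_simplices: "finite (simplices_of_dim K k)"
  using complex by (simp add: simplices_of_dim_def finite_simplicial_complex_def)

lemma stalk_fd: "\<sigma> \<in> K \<Longrightarrow> fd_vectorspace F (stalk C \<sigma>)"
  using cosheaf[unfolded cosheaf_def, THEN conjunct1] by (rule bspec)

lemma stalk_vectorspace: "\<sigma> \<in> simplices_of_dim K k \<Longrightarrow> vectorspace F (stalk C \<sigma>)"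
  using stalk_fd by (simp add: fd_vectorspace_def simplices_of_dim_def)

lemma ext_linear:
  assumes "\<sigma> \<in> K" "\<tau> \<in> K" "\<tau> \<subseteq> \<sigma>"
  shows "linear_map F (stalk C \<sigma>) (stalk C \<tau>) (ext C \<sigma> \<tau>)"
  using cosheaf[unfolded cosheaf_def, THEN conjunct2, THEN conjunct1] assms by simp

lemma facet_map_linear:
  assumes "\<sigma> \<in> K" "\<tau> \<in> K"
  shows "linear_map F (stalk C \<sigma>) (stalk C \<tau>) (facet_map r C \<sigma> \<tau>)"
proof (cases "incidence r \<sigma> \<tau> = 0")
  case True
  have "linear_map F (stalk C \<sigma>) (stalk C \<tau>) (\<lambda>x. \<zero>\<^bsub>stalk C \<tau>\<^esub>)"
    using stalk_fd assms by (intro linear_map_const_zero) (simp_all add: fd_vectorspace_def)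
  moreover have "facet_map r C \<sigma> \<tau> = (\<lambda>x. \<zero>\<^bsub>stalk C \<tau>\<^esub>)"
    using True by (simp add: fun_eq_iff facet_map_zero_incidence)
  ultimately show ?thesis by simp
next
  case False
  then have "\<tau> \<subseteq> \<sigma>" using incidence_nonzero_subset[OF complex orientation assms(1)] by blast
  then show ?thesis
    unfolding facet_map_def[abs_def] using linear_map_add_multiple[OF ext_linear] assms by blast
qed

text \<open>By functoriality, going from \<open>\<sigma>\<close> to \<open>\<rho>\<close> through \<open>\<tau>\<close> is \<open>[\<sigma>:\<tau>][\<tau>:\<rho>]\<close> times \<open>ext C \<sigma> \<rho>\<close>, a map that does not
  depend on \<open>\<tau>\<close>. If \<open>\<rho>\<close> is not a face of \<open>\<sigma>\<close>, then \<open>ext C \<sigma> \<rho> x\<close> need not lie in \<open>stalk C \<rho>\<close>, but then all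
  summands are zero.\<close>

lemma facet_map_square_zero:
  assumes \<sigma>: "\<sigma> \<in> simplices_of_dim K k" and \<rho>: "\<rho> \<in> simplices_of_dim K (k - 2)"
    and x: "x \<in> carrier (stalk C \<sigma>)"
  shows "(\<Oplus>\<^bsub>stalk C \<rho>\<^esub>\<tau>\<in>simplices_of_dim K (k - 1). facet_map r C \<tau> \<rho> (facet_map r C \<sigma> \<tau> x))
    = \<zero>\<^bsub>stalk C \<rho>\<^esub>"
proof -
  let ?V = "stalk C \<rho>"
  interpret V: vectorspace F ?V using \<rho> by (rule stalk_vectorspace)
  have \<sigma>K: "\<sigma> \<in> K" and \<rho>K: "\<rho> \<in> K" using \<sigma> \<rho> by (simp_all add: simplices_of_dim_def)
  have double: "facet_map r C \<tau> \<rho> (facet_map r C \<sigma> \<tau> x)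
      = (if incidence r \<sigma> \<tau> * incidence r \<tau> \<rho> = 0 then \<zero>\<^bsub>?V\<^esub>
         else [(incidence r \<sigma> \<tau> * incidence r \<tau> \<rho>)] \<cdot>\<^bsub>?V\<^esub> ext C \<sigma> \<rho> x)"
    and sub: "incidence r \<sigma> \<tau> * incidence r \<tau> \<rho> \<noteq> 0 \<Longrightarrow> \<rho> \<subseteq> \<sigma>"
    if \<tau>: "\<tau> \<in> simplices_of_dim K (k - 1)" for \<tau>
  proof -
    have \<tau>K: "\<tau> \<in> K" using \<tau> by (simp add: simplices_of_dim_def)
    have faces: "\<tau> \<subseteq> \<sigma>" "\<rho> \<subseteq> \<tau>" if "incidence r \<sigma> \<tau> \<noteq> 0" "incidence r \<tau> \<rho> \<noteq> 0"
      using that incidence_nonzero_subset[OF complex orientation] \<sigma>K \<tau>K by blast+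
    show "\<rho> \<subseteq> \<sigma>" if "incidence r \<sigma> \<tau> * incidence r \<tau> \<rho> \<noteq> 0"
      using faces that by auto
    show "facet_map r C \<tau> \<rho> (facet_map r C \<sigma> \<tau> x)
      = (if incidence r \<sigma> \<tau> * incidence r \<tau> \<rho> = 0 then \<zero>\<^bsub>?V\<^esub>
         else [(incidence r \<sigma> \<tau> * incidence r \<tau> \<rho>)] \<cdot>\<^bsub>?V\<^esub> ext C \<sigma> \<rho> x)"
    proof (cases "incidence r \<sigma> \<tau> * incidence r \<tau> \<rho> = 0")
      case True
      then consider "incidence r \<sigma> \<tau> = 0" | "incidence r \<tau> \<rho> = 0" by auto
      then show ?thesis
      proof cases
        case 1
        then show ?thesis
          using linear_map_zero_vec[OF facet_map_linear[OF \<tau>K \<rho>K]] by (simp add: facet_map_zero_incidence)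
      qed (simp add: facet_map_zero_incidence)
    next
      case False
      then have sub: "\<tau> \<subseteq> \<sigma>" "\<rho> \<subseteq> \<tau>" using faces by auto
      have e: "ext C \<sigma> \<tau> x \<in> carrier (stalk C \<tau>)"
        using linear_map_closed[OF ext_linear[OF \<sigma>K \<tau>K sub(1)] x] .
      have "ext C \<tau> \<rho> (ext C \<sigma> \<tau> x) = ext C \<sigma> \<rho> x"
        using cosheaf[unfolded cosheaf_def, THEN conjunct2, THEN conjunct2, THEN conjunct2]
          \<sigma>K \<tau>K \<rho>K sub x by simp
      moreover have "ext C \<tau> \<rho> (ext C \<sigma> \<tau> x) \<in> carrier ?V"
        using linear_map_closed[OF ext_linear[OF \<tau>K \<rho>K sub(2)] e] .
      ultimately show ?thesis
        using False linear_map_add_pow[OF ext_linear[OF \<tau>K \<rho>K sub(2)] e]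
        by (simp add: facet_map_def V.M.add.int_pow_pow)
    qed
  qed
  show ?thesis
  proof (cases "\<rho> \<subseteq> \<sigma>")
    case True
    have z: "ext C \<sigma> \<rho> x \<in> carrier ?V"
      using linear_map_closed[OF ext_linear[OF \<sigma>K \<rho>K True] x] .
    have "(\<Oplus>\<^bsub>?V\<^esub>\<tau>\<in>simplices_of_dim K (k - 1). facet_map r C \<tau> \<rho> (facet_map r C \<sigma> \<tau> x))
      = (\<Oplus>\<^bsub>?V\<^esub>\<tau>\<in>simplices_of_dim K (k - 1). [(incidence r \<sigma> \<tau> * incidence r \<tau> \<rho>)] \<cdot>\<^bsub>?V\<^esub> ext C \<sigma> \<rho> x)"
      by (rule finsum_cong_unconditional) (simp add: double add_pow_def)
    also have "\<dots> = \<zero>\<^bsub>?V\<^esub>"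
      using V.M.finsum_add_pow[OF finite_simplices z] incidence_square_zero[OF complex orientation \<sigma> \<rho>]
      by (simp add: add_pow_def)
    finally show ?thesis .
  next
    case False
    have "(\<Oplus>\<^bsub>?V\<^esub>\<tau>\<in>simplices_of_dim K (k - 1). facet_map r C \<tau> \<rho> (facet_map r C \<sigma> \<tau> x))
      = (\<Oplus>\<^bsub>?V\<^esub>\<tau>\<in>simplices_of_dim K (k - 1). \<zero>\<^bsub>?V\<^esub>)"
      by (rule finsum_cong_unconditional) (use double sub False in \<open>simp only: if_True split: if_split, blast\<close>)
    then show ?thesis by simp
  qed
qed

lemma chains_fd: "fd_vectorspace F (chains (cosheaf_complex K r C) k)"
  unfolding cosheaf_complex_simps
  using stalk_fd simplices_of_dim_subset by (intro family_direct_sum_fd field finite_simplices) blast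

lemma bdry_linear:
  "linear_map F (chains (cosheaf_complex K r C) k) (chains (cosheaf_complex K r C) (k - 1))
     (bdry (cosheaf_complex K r C) k)"
proof -
  have vs: "vectorspace F (family_direct_sum (simplices_of_dim K k) (stalk C))"
    using field stalk_vectorspace by (rule family_direct_sum_vectorspace)
  show ?thesis
    unfolding cosheaf_complex_simps cosheaf_complex_simps[abs_def]
  proof (intro linear_map_into_family linear_map_finsum vs field finite_simplices)
    show "linear_map F (family_direct_sum (simplices_of_dim K k) (stalk C)) (stalk C \<tau>)
        (\<lambda>x. facet_map r C \<sigma> \<tau> (x \<sigma>))"
      if "\<tau> \<in> simplices_of_dim K (k - 1)" "\<sigma> \<in> simplices_of_dim K k" for \<sigma> \<tau>
      using that simplices_of_dim_subset
      by (intro linear_map_compose[where T = "facet_map r C \<sigma> \<tau>" and S = "\<lambda>x. x \<sigma>" and V = "stalk C \<sigma>"]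
            facet_map_linear linear_map_coordinate field stalk_vectorspace) blast+
  qed (rule stalk_vectorspace)
qed

text \<open>The component of \<open>\<partial>\<partial>x\<close> at \<open>\<rho>\<close> is a double sum over \<open>\<tau>\<close> and \<open>\<sigma>\<close>; summing over \<open>\<tau>\<close> first makes it vanish
  term by term.\<close>

theorem cosheaf_complex_fd_chain_complex: "fd_chain_complex F (cosheaf_complex K r C)"
  unfolding fd_chain_complex_def
proof (intro conjI allI ballI chains_fd bdry_linear)
  fix k x assume "x \<in> carrier (chains (cosheaf_complex K r C) k)"
  then have x: "x \<sigma> \<in> carrier (stalk C \<sigma>)" if "\<sigma> \<in> simplices_of_dim K k" for \<sigma>
    using that by (auto simp: cosheaf_complex_simps family_direct_sum_simps)
  have "(\<Oplus>\<^bsub>stalk C \<rho>\<^esub>\<tau>\<in>simplices_of_dim K (k - 1). facet_map r C \<tau> \<rho>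
        (\<Oplus>\<^bsub>stalk C \<tau>\<^esub>\<sigma>\<in>simplices_of_dim K k. facet_map r C \<sigma> \<tau> (x \<sigma>))) = \<zero>\<^bsub>stalk C \<rho>\<^esub>"
    if \<rho>: "\<rho> \<in> simplices_of_dim K (k - 2)" for \<rho>
  proof -
    interpret V: vectorspace F "stalk C \<rho>" using \<rho> by (rule stalk_vectorspace)
    have facet: "linear_map F (stalk C \<sigma>) (stalk C \<tau>) (facet_map r C \<sigma> \<tau>)"
      if "\<sigma> \<in> simplices_of_dim K i" "\<tau> \<in> simplices_of_dim K j" for \<sigma> \<tau> i j
      using that simplices_of_dim_subset by (intro facet_map_linear) blast+
    have c: "facet_map r C \<sigma> \<tau> (x \<sigma>) \<in> carrier (stalk C \<tau>)"
      if "\<sigma> \<in> simplices_of_dim K k" "\<tau> \<in> simplices_of_dim K (k - 1)" for \<sigma> \<tau>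
      using linear_map_closed[OF facet[OF that] x[OF that(1)]] .
    have "(\<Oplus>\<^bsub>stalk C \<rho>\<^esub>\<tau>\<in>simplices_of_dim K (k - 1). facet_map r C \<tau> \<rho>
          (\<Oplus>\<^bsub>stalk C \<tau>\<^esub>\<sigma>\<in>simplices_of_dim K k. facet_map r C \<sigma> \<tau> (x \<sigma>)))
      = (\<Oplus>\<^bsub>stalk C \<rho>\<^esub>\<tau>\<in>simplices_of_dim K (k - 1). \<Oplus>\<^bsub>stalk C \<rho>\<^esub>\<sigma>\<in>simplices_of_dim K k.
          facet_map r C \<tau> \<rho> (facet_map r C \<sigma> \<tau> (x \<sigma>)))"
    proof (rule finsum_cong_unconditional)
      fix \<tau> assume \<tau>: "\<tau> \<in> simplices_of_dim K (k - 1)"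
      show "facet_map r C \<tau> \<rho> (\<Oplus>\<^bsub>stalk C \<tau>\<^esub>\<sigma>\<in>simplices_of_dim K k. facet_map r C \<sigma> \<tau> (x \<sigma>))
        = (\<Oplus>\<^bsub>stalk C \<rho>\<^esub>\<sigma>\<in>simplices_of_dim K k. facet_map r C \<tau> \<rho> (facet_map r C \<sigma> \<tau> (x \<sigma>)))"
        using linear_map_of_finsum[where x = "\<lambda>\<sigma>. facet_map r C \<sigma> \<tau> (x \<sigma>)",
            OF facet[OF \<tau> \<rho>] finite_simplices c[OF _ \<tau>]] by simp
    qed
    also have "\<dots> = (\<Oplus>\<^bsub>stalk C \<rho>\<^esub>\<sigma>\<in>simplices_of_dim K k. \<Oplus>\<^bsub>stalk C \<rho>\<^esub>\<tau>\<in>simplices_of_dim K (k - 1).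
          facet_map r C \<tau> \<rho> (facet_map r C \<sigma> \<tau> (x \<sigma>)))"
      by (rule V.M.finsum_swap) (use linear_map_closed[OF facet[OF _ \<rho>] c] in \<open>auto intro: finite_simplices\<close>)
    also have "\<dots> = (\<Oplus>\<^bsub>stalk C \<rho>\<^esub>\<sigma>\<in>simplices_of_dim K k. \<zero>\<^bsub>stalk C \<rho>\<^esub>)"
      by (rule finsum_cong_unconditional) (rule facet_map_square_zero[OF _ \<rho> x])
    finally show ?thesis by simp
  qed
  note square = this
  have "(\<Oplus>\<^bsub>stalk C \<rho>\<^esub>\<tau>\<in>simplices_of_dim K (k - 1).
      facet_map r C \<tau> \<rho> (bdry (cosheaf_complex K r C) k x \<tau>)) = \<zero>\<^bsub>stalk C \<rho>\<^esub>"
    if "\<rho> \<in> simplices_of_dim K (k - 2)" for \<rho>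
    unfolding square[OF that, symmetric]
    by (rule finsum_cong_unconditional) (simp add: cosheaf_complex_simps)
  moreover have "k - 1 - 1 = k - 2" by simp
  ultimately show "bdry (cosheaf_complex K r C) (k - 1) (bdry (cosheaf_complex K r C) k x)
      = \<zero>\<^bsub>chains (cosheaf_complex K r C) (k - 2)\<^esub>"
    unfolding cosheaf_complex_simps(1) cosheaf_complex_simps(2)[of _ _ _ "k - 1"] family_direct_sum_simps
    by (metis (no_types, lifting) restrict_ext)
qed

text \<open>Compare the components at \<open>\<tau>\<close>. Simplices outside \<open>N\<close> carry zero, so both sides agree when \<open>\<tau>\<close> is in \<open>N\<close>.
  Otherwise the extension of the boundary is zero at \<open>\<tau>\<close>, and so is the boundary of the extension,
  because no simplex of \<open>N\<close> has \<open>\<tau>\<close> as a facet.\<close>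

theorem zero_extend_chain_map:
  assumes N: "subcomplex N K"
  shows "chain_map F (cosheaf_complex N r C) (cosheaf_complex K r C)
    (\<lambda>k. zero_extend (stalk C) (simplices_of_dim N k) (simplices_of_dim K k))"
  unfolding chain_map_def
proof (intro conjI allI ballI)
  interpret N: oriented_cosheaf F N r C using N by (rule oriented_cosheaf_subcomplex)
  have NK: "simplices_of_dim N k \<subseteq> simplices_of_dim K k" for k
    using N by (auto simp: subcomplex_def simplices_of_dim_def)
  show "linear_map F (chains (cosheaf_complex N r C) k) (chains (cosheaf_complex K r C) k)
      (zero_extend (stalk C) (simplices_of_dim N k) (simplices_of_dim K k))" for k
    unfolding cosheaf_complex_simps using field stalk_vectorspace NK by (rule zero_extend_linear)
  fix k x assume "x \<in> carrier (chains (cosheaf_complex N r C) k)"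
  then have x: "x \<sigma> \<in> carrier (stalk C \<sigma>)" if "\<sigma> \<in> simplices_of_dim N k" for \<sigma>
    using that by (auto simp: cosheaf_complex_simps family_direct_sum_simps)
  let ?z = "zero_extend (stalk C) (simplices_of_dim N k) (simplices_of_dim K k) x"
  have "(\<Oplus>\<^bsub>stalk C \<tau>\<^esub>\<sigma>\<in>simplices_of_dim K k. facet_map r C \<sigma> \<tau> (?z \<sigma>))
      = (if \<tau> \<in> simplices_of_dim N (k - 1)
         then \<Oplus>\<^bsub>stalk C \<tau>\<^esub>\<sigma>\<in>simplices_of_dim N k. facet_map r C \<sigma> \<tau> (x \<sigma>) else \<zero>\<^bsub>stalk C \<tau>\<^esub>)"
    if \<tau>: "\<tau> \<in> simplices_of_dim K (k - 1)" for \<tau>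
  proof -
    interpret V: vectorspace F "stalk C \<tau>" using \<tau> by (rule stalk_vectorspace)
    have facet: "linear_map F (stalk C \<sigma>) (stalk C \<tau>) (facet_map r C \<sigma> \<tau>)"
      if "\<sigma> \<in> simplices_of_dim K k" for \<sigma>
      using that \<tau> simplices_of_dim_subset by (intro facet_map_linear) blast+
    have outside: "facet_map r C \<sigma> \<tau> (?z \<sigma>) = \<zero>\<^bsub>stalk C \<tau>\<^esub>"
      if "\<sigma> \<in> simplices_of_dim K k - simplices_of_dim N k" for \<sigma>
      using that linear_map_zero_vec[OF facet] by (simp add: zero_extend_def)
    show ?thesis
    proof (cases "\<tau> \<in> simplices_of_dim N (k - 1)")
      case True
      have "(\<Oplus>\<^bsub>stalk C \<tau>\<^esub>\<sigma>\<in>simplices_of_dim N k. facet_map r C \<sigma> \<tau> (x \<sigma>))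
        = (\<Oplus>\<^bsub>stalk C \<tau>\<^esub>\<sigma>\<in>simplices_of_dim K k. facet_map r C \<sigma> \<tau> (?z \<sigma>))"
      proof (rule V.M.add.finprod_mono_neutral_cong_left[OF finite_simplices NK])
        show "(\<lambda>\<sigma>. facet_map r C \<sigma> \<tau> (?z \<sigma>)) \<in> simplices_of_dim K k \<rightarrow> carrier (stalk C \<tau>)"
        proof
          fix \<sigma> assume "\<sigma> \<in> simplices_of_dim K k"
          then show "facet_map r C \<sigma> \<tau> (?z \<sigma>) \<in> carrier (stalk C \<tau>)"
            using outside linear_map_closed[OF facet x] by (cases "\<sigma> \<in> simplices_of_dim N k") (auto simp: zero_extend_def)
        qed
      qed (use outside NK in \<open>auto simp: zero_extend_def\<close>)
      with True show ?thesis by simp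
    next
      case False
      then have "\<tau> \<notin> N" using \<tau> by (simp add: simplices_of_dim_def)
      have "facet_map r C \<sigma> \<tau> (?z \<sigma>) = \<zero>\<^bsub>stalk C \<tau>\<^esub>" if "\<sigma> \<in> simplices_of_dim K k" for \<sigma>
      proof (cases "\<sigma> \<in> simplices_of_dim N k")
        case True
        have "incidence r \<sigma> \<tau> = 0"
        proof (rule ccontr)
          assume "incidence r \<sigma> \<tau> \<noteq> 0"
          moreover have "\<sigma> \<in> N" "\<tau> \<noteq> {}"
            using True \<tau> complex by (auto simp: simplices_of_dim_def finite_simplicial_complex_def)
          ultimately show False
            using \<open>\<tau> \<notin> N\<close> finite_simplicial_complex_face[OF N.complex]
              incidence_nonzero_subset[OF N.complex N.orientation] by blast
        qed
        then show ?thesis by (rule facet_map_zero_incidence)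
      next
        case False
        then show ?thesis using outside that by blast
      qed
      then have "(\<Oplus>\<^bsub>stalk C \<tau>\<^esub>\<sigma>\<in>simplices_of_dim K k. facet_map r C \<sigma> \<tau> (?z \<sigma>))
          = (\<Oplus>\<^bsub>stalk C \<tau>\<^esub>\<sigma>\<in>simplices_of_dim K k. \<zero>\<^bsub>stalk C \<tau>\<^esub>)"
        by (rule finsum_cong_unconditional)
      with False show ?thesis by simp
    qed
  qed
  then show "zero_extend (stalk C) (simplices_of_dim N (k - 1)) (simplices_of_dim K (k - 1))
      (bdry (cosheaf_complex N r C) k x)
      = bdry (cosheaf_complex K r C) k ?z"
    unfolding cosheaf_complex_simps zero_extend_def[of _ _ "simplices_of_dim K (k - 1)"]
    by (intro restrict_ext) simp
qed

end

section \<open>The short exact sequence\<close>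

theorem theorem4p2:
  fixes F :: "('f, 'm) ring_scheme"
    and K L M I :: "'v set set"
    and r :: "'v set \<Rightarrow> 'v rel"
    and C :: "('v, 'f, 'b) cosheaf_data"
  assumes "field F"
    and "finite_simplicial_complex K"
    and "local_orientation K r"
    and "subcomplex L K" and "subcomplex M K"
    and "K = L \<union> M"
    and "I = L \<inter> M"
    and "cosheaf F K C"
  shows "\<exists>p q. short_exact_complexes F
    (cosheaf_complex I r (cosheaf_restrict C I)) p
    (direct_sum_complex (cosheaf_complex L r (cosheaf_restrict C L))
                        (cosheaf_complex M r (cosheaf_restrict C M))) q
    (cosheaf_complex K r C)"
proof -
  interpret K: oriented_cosheaf F K r C by (rule oriented_cosheaf.intro[OF assms(1,2,3,8)])
  interpret L: oriented_cosheaf F L r C using assms(4) by (rule K.oriented_cosheaf_subcomplex)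
  interpret M: oriented_cosheaf F M r C using assms(5) by (rule K.oriented_cosheaf_subcomplex)
  have I: "subcomplex I L" "subcomplex I M"
    using finite_simplicial_complex_Int[OF L.complex M.complex] by (simp_all add: subcomplex_def assms(7))
  interpret I: oriented_cosheaf F I r C using I(1) by (rule L.oriented_cosheaf_subcomplex)
  let ?S = "\<lambda>N. simplices_of_dim N" and ?V = "stalk C"
  let ?p = "\<lambda>k x. (zero_extend ?V (?S I k) (?S L k) x, zero_extend ?V (?S I k) (?S M k) x)"
  let ?q = "\<lambda>k y. zero_extend ?V (?S L k) (?S K k) (fst y)
      \<ominus>\<^bsub>chains (cosheaf_complex K r C) k\<^esub> zero_extend ?V (?S M k) (?S K k) (snd y)"
  let ?A = "cosheaf_complex I r C" and ?D = "cosheaf_complex K r C"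
  let ?B = "direct_sum_complex (cosheaf_complex L r C) (cosheaf_complex M r C)"
  have dims: "?S I k = ?S L k \<inter> ?S M k" "?S K k = ?S L k \<union> ?S M k" for k
    by (auto simp: assms(6,7) simplices_of_dim_def)
  have V: "vectorspace F (?V \<sigma>)" if "\<sigma> \<in> ?S L k \<union> ?S M k" for \<sigma> k
    using that K.stalk_vectorspace[of \<sigma> k] by (simp add: dims)
  have cc: "fd_chain_complex F ?A" "fd_chain_complex F ?B" "fd_chain_complex F ?D"
    by (intro direct_sum_fd_chain_complex I.cosheaf_complex_fd_chain_complex
        L.cosheaf_complex_fd_chain_complex M.cosheaf_complex_fd_chain_complex
        K.cosheaf_complex_fd_chain_complex)+
  have p: "chain_map F ?A ?B ?p"
    by (intro chain_map_pair L.zero_extend_chain_map M.zero_extend_chain_map I)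
  have q: "chain_map F ?B ?D ?q"
    by (intro chain_map_difference K.zero_extend_chain_map assms cc)
  have plin: "linear_map F (chains ?A k) (chains ?B k) (?p k)"
    and qlin: "linear_map F (chains ?B k) (chains ?D k) (?q k)" for k
    using p q by (simp_all add: chain_map_def)
  have chB: "chains ?B k = direct_sum (family_direct_sum (?S L k) ?V) (family_direct_sum (?S M k) ?V)" for k
    by (simp add: direct_sum_complex_def cosheaf_complex_simps)
  have injective: "mod_hom.ker (chains ?A k) (chains ?B k) (?p k) = {\<zero>\<^bsub>chains ?A k\<^esub>}" for k
  proof -
    have "\<zero>\<^bsub>chains ?A k\<^esub> \<in> carrier (chains ?A k)"
      using linear_map_vectorspaces(1)[OF plin, of k] vectorspace_abelian_group
        abelian_group.axioms(1) abelian_monoid.zero_closed by blast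
    moreover have "x = \<zero>\<^bsub>chains ?A k\<^esub>"
      if "x \<in> carrier (chains ?A k)" "?p k x = \<zero>\<^bsub>chains ?B k\<^esub>" for x
      using that zero_extend_pair_injective[where S = "?S L k" and T = "?S M k" and V = ?V, OF assms(1) V]
      by (simp add: chB cosheaf_complex_simps dims(1) direct_sum_def)
    ultimately show ?thesis
      unfolding linear_map_ker[OF plin] using linear_map_zero_vec[OF plin, of k] by blast
  qed
  have middle: "?p k ` carrier (chains ?A k) = mod_hom.ker (chains ?B k) (chains ?D k) (?q k)" for k
    unfolding linear_map_ker[OF qlin]
    using zero_extend_exact_middle[where S = "?S L k" and T = "?S M k" and V = ?V, OF assms(1) V]
    by (simp add: chB cosheaf_complex_simps dims)
  have surjective: "?q k ` carrier (chains ?B k) = carrier (chains ?D k)" for k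
    using zero_extend_difference_surjective[where S = "?S L k" and T = "?S M k" and V = ?V, OF assms(1) V]
    by (simp add: chB cosheaf_complex_simps dims)
  have "short_exact_complexes F ?A ?p ?B ?q ?D"
    unfolding short_exact_complexes_def
    by (intro conjI allI cc p q injective middle surjective)
  then show ?thesis
    unfolding cosheaf_complex_restrict by blast
qed

end
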